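(* Let $\theta>0$, $c_n=\langle n\rangle^{-(\frac12+\theta)}$ for $n\in\mathbb{Z}$, $z_0>0$, and let $(g_n)_{n\in\mathbb{Z}}$ be i.i.d. standard complex Gaussian random variables. Let $u_0=\sum_{n}c_ng_ne^{inx}$ and, for $\epsilon>0$, $$u_{app}(t,x)=e^{-2it\epsilon^2\frac{1}{2\pi}\|u_0\|_{L^2_x}^2}\sum_{n\in\mathbb{Z}}c_ng_n\,e^{inx}\,e^{it\epsilon^2c_n^2|g_n|^2-itn^2}.$$ Let $T_\epsilon>0$ with $T_\epsilon=O(\epsilon^{-1})$. Then $$\lim_{\epsilon\to0^+}\epsilon\,\ln\mathbb{P}\Big(\|u_{app}\|_{L^\infty_{t,x}([0,T_\epsilon]\times\mathbb{T})}>z_0\epsilon^{-\frac12}\Big)=-\frac{z_0^2}{\sum_{n\in\mathbb{Z}}c_n^2}.$$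
   Context: $\mathbb{T}=\mathbb{R}/2\pi\mathbb{Z}$, $\langle n\rangle=(1+|n|^2)^{1/2}$, and $\|f\|_{L^2_x}^2=\int_0^{2\pi}|f|^2dx$. A standard complex Gaussian $g$ is a centered circularly symmetric complex Gaussian with $\mathbb{E}|g|^2=1$. $T_\epsilon=O(\epsilon^{-1})$ means $T_\epsilon\le K\epsilon^{-1}$ with $K$ independent of $\epsilon$. *)

theory Defs
  imports "HOL-Probability.Probability"
begin

definition japanese_bracket :: "int \<Rightarrow> real" where
  "japanese_bracket n = (1 + \<bar>real_of_int n\<bar>\<^sup>2) powr (1 / 2)"

definition coeff_c :: "real \<Rightarrow> int \<Rightarrow> real" where
  "coeff_c \<theta> n = japanese_bracket n powr (- (1 / 2 + \<theta>))"

(* A complex random variable is Gaussian when it has the law of an affine image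
   m + s * a + t * b of a pair (s, t) of independent standard real Gaussians;
   degenerate laws are allowed. *)
definition complex_gaussian :: "'a measure \<Rightarrow> ('a \<Rightarrow> complex) \<Rightarrow> bool" where
  "complex_gaussian M X \<longleftrightarrow>
     X \<in> borel_measurable M \<and>
     (\<exists>m a b :: complex.
        distr M borel X =
        distr (density lborel (\<lambda>s. ennreal (std_normal_density s)) \<Otimes>\<^sub>M
               density lborel (\<lambda>t. ennreal (std_normal_density t)))
          borel (\<lambda>(s, t). m + of_real s * a + of_real t * b))"

definition circularly_symmetric :: "'a measure \<Rightarrow> ('a \<Rightarrow> complex) \<Rightarrow> bool" where
  "circularly_symmetric M X \<longleftrightarrow>
     (\<forall>\<phi>::real. distr M borel (\<lambda>\<omega>. cis \<phi> * X \<omega>) = distr M borel X)"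

definition standard_complex_gaussian :: "'a measure \<Rightarrow> ('a \<Rightarrow> complex) \<Rightarrow> bool" where
  "standard_complex_gaussian M X \<longleftrightarrow>
     complex_gaussian M X \<and>
     (LINT \<omega>|M. X \<omega>) = 0 \<and>
     circularly_symmetric M X \<and>
     (LINT \<omega>|M. (cmod (X \<omega>))\<^sup>2) = 1"

(* Series over the integers are limits of symmetric partial sums, as usual for Fourier
   series. Unconditional summation (infsum) would be wrong here: for \<theta> \<le> 1/2 the random
   series below almost surely do not converge absolutely. *)
definition series_int :: "(int \<Rightarrow> complex) \<Rightarrow> complex" where
  "series_int f = lim (\<lambda>N::nat. \<Sum>n\<in>{- int N..int N}. f n)"

(* Functions on the torus are functions of a real variable x, considered on the
   fundamental domain [0, 2 * pi]. *)
definition L2x_norm :: "(real \<Rightarrow> complex) \<Rightarrow> real" where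
  "L2x_norm f = sqrt (LINT x:{0..2 * pi}|lborel. (cmod (f x))\<^sup>2)"

(* The essential supremum over [0, T] x [0, 2 * pi]; it may be infinite. *)
definition Linf_norm :: "real \<Rightarrow> (real \<Rightarrow> real \<Rightarrow> complex) \<Rightarrow> ereal" where
  "Linf_norm T u =
     esssup (restrict_space lborel ({0..T} \<times> {0..2 * pi}))
       (\<lambda>p::real \<times> real. ereal (cmod (u (fst p) (snd p))))"

(* In the next two definitions G is a realization n \<mapsto> g_n(\<omega>) of the Gaussian family. *)
definition u0 :: "real \<Rightarrow> (int \<Rightarrow> complex) \<Rightarrow> real \<Rightarrow> complex" where
  "u0 \<theta> G x =
     series_int (\<lambda>n. of_real (coeff_c \<theta> n) * G n * exp (\<i> * of_int n * of_real x))"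

definition u_app :: "real \<Rightarrow> (int \<Rightarrow> complex) \<Rightarrow> real \<Rightarrow> real \<Rightarrow> real \<Rightarrow> complex" where
  "u_app \<theta> G \<epsilon> t x =
     exp (- 2 * \<i> * of_real (t * \<epsilon>\<^sup>2 * (1 / (2 * pi)) * (L2x_norm (u0 \<theta> G))\<^sup>2)) *
     series_int (\<lambda>n.
       of_real (coeff_c \<theta> n) * G n * exp (\<i> * of_int n * of_real x) *
       exp (\<i> * of_real (t * \<epsilon>\<^sup>2 * (coeff_c \<theta> n)\<^sup>2 * (cmod (G n))\<^sup>2)
            - \<i> * of_real (t * (real_of_int n)\<^sup>2)))"

end

(*
  Only the modulus of u_app matters, so the phase involving the L2 norm disappears. Split the series
  into the frequencies |n| < 2^k and a tail.

  Tail: each dyadic block is a sum of independent symmetric terms with subgaussian tails at every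
  fixed (t, x). A union bound over a net of the space-time box, whose cardinality is polynomial in
  1/eps and in the frequency, shows that outside an event of probability O(eps^(-1) exp(-A/eps)) the
  series converges at every point and the tail is at most delta * eps^(-1/2). Here A and delta are
  arbitrary, provided k is large.

  Low frequencies, upper bound: the modulus is at most the sum of the c_n |g_n|, and by Cauchy-Schwarz
  a value above z forces the sum of finitely many |g_n|^2 to exceed z^2 / S with S the sum of the
  c_n^2, which has probability at most C_mu exp(-mu z^2 / S) for every mu < 1. Lower bound: at
  t = x = 0 the real part of the low-frequency sum is a real Gaussian whose variance tends to S/2, and
  by continuity a large value there persists on a set of positive measure.
*)

theory Submission
  imports Defs "HOL-Real_Asymp.Real_Asymp"
begin

section \<open>Standard complex Gaussians\<close>

text \<open>The phases contain \<open>cmod (g n)\<close>, so the field is not a Gaussian process and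
  concentration results for such processes do not apply to it. What survives is that each term is an
  odd function of \<open>g n\<close> with modulus c_n |g_n|, and the subgaussian bounds rest on
  these two facts alone. Absolute values are too crude in the tail: for \<theta> at most 1/2 the sum
  of c_n |g_n| diverges almost surely. Cancellation has to be exploited pointwise and then made
  uniform over a box whose length grows like 1/eps. The phase speeds on which a net depends are
  themselves random, so the exceptional events also include large values of |g_n|; the factor eps^2
  in the phase makes the level 2^k eps^(-1/2) harmless. The two bounds meet because |g_n|^2 is
  exponential with mean 1: forcing the sum of the |g_n|^2 above z^2 / (S eps) costs exp(-z^2 / (S
  eps)) up to lower order, and so does a normal variable of variance S/2 exceeding z eps^(-1/2).
  Constants that depend on the cutoff k, and powers of 1/eps, vanish under eps ln.\<close>

lemma exp_add_exp_neg_le: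
  fixes y :: real
  shows "exp y + exp (- y) \<le> 2 * exp (y\<^sup>2)"
proof -
  have main: "exp y + exp (- y) \<le> 2 * exp (y\<^sup>2)" if y: "0 \<le> y" for y :: real
  proof (cases "y \<le> 1")
    case True
    have "exp y \<le> 1 + y + y\<^sup>2"
      using exp_bound[OF y True] .
    moreover have "exp (- y) \<le> 1 - y + y\<^sup>2"
    proof -
      \<comment> \<open>The product equals 1 + y^3.\<close>
      have "1 \<le> (1 - y + y\<^sup>2) * (1 + y)"
        using y by (simp add: algebra_simps power2_eq_square)
      also have "\<dots> \<le> (1 - y + y\<^sup>2) * exp y"
        using True by (intro mult_left_mono exp_ge_add_one_self) auto
      finally show ?thesis
        by (simp add: exp_minus field_simps)
    qed
    moreover have "1 + y\<^sup>2 \<le> exp (y\<^sup>2)"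
      by (rule exp_ge_add_one_self)
    ultimately show ?thesis by linarith
  next
    case False
    then have "y \<le> y\<^sup>2"
      by (simp add: power2_eq_square)
    with y have "exp y \<le> exp (y\<^sup>2)" "exp (- y) \<le> exp (y\<^sup>2)"
      by (auto intro: order_trans[of _ 0])
    then show ?thesis by linarith
  qed
  show ?thesis
    using main[of y] main[of "- y"] by (cases "0 \<le> y") (auto simp: add.commute)
qed

text \<open>Multiplying the standard normal density by this exponential only changes its variance,
  to 1 / (1 - \<mu>); the value of the integral is the ratio \<sigma> of the two
  normalizations.\<close>

lemma std_normal_nn_integral_exp_square:
  assumes "\<mu> < 1"
  shows "(\<integral>\<^sup>+s. ennreal (exp (\<mu> * s\<^sup>2 / 2)) \<partial>std_normal_distribution) = ennreal (1 / sqrt (1 - \<mu>))"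
proof -
  define \<sigma> where "\<sigma> = 1 / sqrt (1 - \<mu>)"
  have \<sigma>: "\<sigma> > 0" and \<sigma>2: "\<sigma>\<^sup>2 = 1 / (1 - \<mu>)"
    using assms by (auto simp: \<sigma>_def power_divide)
  have "(\<integral>\<^sup>+s. ennreal (exp (\<mu> * s\<^sup>2 / 2)) \<partial>std_normal_distribution)
      = (\<integral>\<^sup>+s. ennreal (\<sigma> * normal_density 0 \<sigma> s) \<partial>lborel)"
  proof (subst nn_integral_density; (intro nn_integral_cong)?)
    fix s :: real
    have "exp (- s\<^sup>2 / (2 * \<sigma>\<^sup>2)) = exp (- s\<^sup>2 / 2) * exp (\<mu> * s\<^sup>2 / 2)"
      using assms by (simp add: \<sigma>2 exp_add[symmetric] field_simps)
    then show "ennreal (std_normal_density s) * ennreal (exp (\<mu> * s\<^sup>2 / 2)) = ennreal (\<sigma> * normal_density 0 \<sigma> s)"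
      using \<sigma> by (subst ennreal_mult[symmetric]) (auto simp: normal_density_def real_sqrt_mult)
  qed auto
  also have "\<dots> = ennreal (\<integral>s. \<sigma> * normal_density 0 \<sigma> s \<partial>lborel)"
    using \<sigma> by (intro nn_integral_eq_integral) auto
  also have "\<dots> = ennreal \<sigma>"
    using \<sigma> by simp
  finally show ?thesis by (simp add: \<sigma>_def)
qed

lemma (in pair_prob_space) product_integral:
  fixes f g :: "_ \<Rightarrow> real"
  assumes f: "integrable M1 f" and g: "integrable M2 g"
  shows "integrable (M1 \<Otimes>\<^sub>M M2) (\<lambda>p. f (fst p) * g (snd p))"
    and "(\<integral>p. f (fst p) * g (snd p) \<partial>(M1 \<Otimes>\<^sub>M M2)) = (\<integral>x. f x \<partial>M1) * (\<integral>y. g y \<partial>M2)"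
proof -
  have [measurable]: "f \<in> borel_measurable M1" "g \<in> borel_measurable M2"
    using f g by auto
  show int: "integrable (M1 \<Otimes>\<^sub>M M2) (\<lambda>p. f (fst p) * g (snd p))"
    using f g by (intro Fubini_integrable) (auto simp: abs_mult)
  show "(\<integral>p. f (fst p) * g (snd p) \<partial>(M1 \<Otimes>\<^sub>M M2)) = (\<integral>x. f x \<partial>M1) * (\<integral>y. g y \<partial>M2)"
    using integral_fst'[OF int] by simp
qed

abbreviation std_normal_pair :: "(real \<times> real) measure" where
  "std_normal_pair \<equiv> std_normal_distribution \<Otimes>\<^sub>M std_normal_distribution"

lemma prob_space_std_normal: "prob_space std_normal_distribution"
  by (rule prob_space_normal_density) simp

lemma pair_prob_space_std_normal:
  "pair_prob_space std_normal_distribution std_normal_distribution"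
  by (simp add: pair_prob_space_def pair_sigma_finite_def prob_space_std_normal
      prob_space_imp_sigma_finite)

lemma std_normal_moments:
  "integrable std_normal_distribution (\<lambda>s. s)"
  "integrable std_normal_distribution (\<lambda>s. s\<^sup>2)"
  "integral\<^sup>L std_normal_distribution (\<lambda>s. s) = 0" "integral\<^sup>L std_normal_distribution (\<lambda>s. s\<^sup>2) = 1"
  using integrable_std_normal_distribution_moment[of 1] integrable_std_normal_distribution_moment[of 2]
    integral_std_normal_distribution_moment_odd[of 1] std_normal_distribution_even_moments[of 1]
  by simp_all

lemma std_normal_pair_moments:
  "has_bochner_integral std_normal_pair (\<lambda>_. 1::real) 1"
  "has_bochner_integral std_normal_pair (\<lambda>p. fst p) 0"
  "has_bochner_integral std_normal_pair (\<lambda>p. snd p) 0"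
  "has_bochner_integral std_normal_pair (\<lambda>p. (fst p)\<^sup>2) 1"
  "has_bochner_integral std_normal_pair (\<lambda>p. (snd p)\<^sup>2) 1"
  "has_bochner_integral std_normal_pair (\<lambda>p. fst p * snd p) 0"
proof -
  interpret pair_prob_space std_normal_distribution std_normal_distribution
    by (rule pair_prob_space_std_normal)
  note P = product_integral
  have 1: "integrable std_normal_distribution (\<lambda>_. 1::real)"
    by simp
  show "has_bochner_integral std_normal_pair (\<lambda>_. 1::real) 1"
    by (simp add: has_bochner_integral_iff prob_space)
  show "has_bochner_integral std_normal_pair (\<lambda>p. fst p) 0"
    using P[OF std_normal_moments(1) 1] std_normal_moments(3) by (simp add: has_bochner_integral_iff)
  show "has_bochner_integral std_normal_pair (\<lambda>p. snd p) 0"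
    using P[OF 1 std_normal_moments(1)] std_normal_moments(3) by (simp add: has_bochner_integral_iff)
  show "has_bochner_integral std_normal_pair (\<lambda>p. (fst p)\<^sup>2) 1"
    using P[OF std_normal_moments(2) 1] std_normal_moments(4) M1.prob_space
    by (simp add: has_bochner_integral_iff)
  show "has_bochner_integral std_normal_pair (\<lambda>p. (snd p)\<^sup>2) 1"
    using P[OF 1 std_normal_moments(2)] std_normal_moments(4) M1.prob_space
    by (simp add: has_bochner_integral_iff)
  show "has_bochner_integral std_normal_pair (\<lambda>p. fst p * snd p) 0"
    using P[OF std_normal_moments(1) std_normal_moments(1)]
    unfolding has_bochner_integral_iff std_normal_moments(3) by simp
qed

lemma integral_eq_of_distr_eq:
  fixes h :: "complex \<Rightarrow> 'b::{banach, second_countable_topology}"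
  assumes "distr M borel X = distr N borel Y"
    and "X \<in> borel_measurable M" "Y \<in> borel_measurable N" "h \<in> borel_measurable borel"
  shows "(\<integral>\<omega>. h (X \<omega>) \<partial>M) = (\<integral>\<omega>. h (Y \<omega>) \<partial>N)"
  using integral_distr[OF assms(2,4)] integral_distr[OF assms(3,4)] unfolding assms(1) by simp

lemma nn_integral_eq_of_distr_eq:
  assumes "distr M borel X = distr N borel Y"
    and "X \<in> borel_measurable M" "Y \<in> borel_measurable N" "h \<in> borel_measurable borel"
  shows "(\<integral>\<^sup>+\<omega>. h (X \<omega>) \<partial>M) = (\<integral>\<^sup>+\<omega>. h (Y \<omega>) \<partial>N)"
  using nn_integral_distr[OF assms(2), of h] nn_integral_distr[OF assms(3), of h] assms(4)
  unfolding assms(1) by simp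

lemma distr_compose_eq:
  assumes "distr M borel X = distr N borel Y"
    and "X \<in> borel_measurable M" "Y \<in> borel_measurable N" "h \<in> borel_measurable borel"
  shows "distr M borel (\<lambda>\<omega>. h (X \<omega>)) = distr N borel (\<lambda>\<omega>. h (Y \<omega>))"
  using distr_distr[OF assms(4,2)] distr_distr[OF assms(4,3)] unfolding assms(1) comp_def by simp

lemma standard_complex_gaussian_measurable:
  "standard_complex_gaussian M X \<Longrightarrow> X \<in> borel_measurable M"
  by (simp add: standard_complex_gaussian_def complex_gaussian_def)

text \<open>The mean forces \<open>m = 0\<close>. Rotation by a right angle gives \<open>E X\<^sup>2 = a\<^sup>2 + b\<^sup>2 = 0\<close>, so
  \<open>b = \<plusminus>\<i> a\<close>; a further rotation makes \<open>a\<close> real.\<close>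

lemma standard_complex_gaussian_law:
  assumes X: "standard_complex_gaussian M X"
  obtains \<sigma> :: complex where "\<sigma> = 1 \<or> \<sigma> = - 1"
    "distr M borel X = distr std_normal_pair borel
       (\<lambda>p. (of_real (fst p) + \<i> * \<sigma> * of_real (snd p)) / of_real (sqrt 2))"
proof -
  from X obtain m a b where
    law: "distr M borel X = distr std_normal_pair borel (\<lambda>(s, t). m + of_real s * a + of_real t * b)"
    unfolding standard_complex_gaussian_def complex_gaussian_def by auto
  have [measurable]: "X \<in> borel_measurable M"
    using X by (rule standard_complex_gaussian_measurable)
  define Y where "Y p = m + of_real (fst p) * a + of_real (snd p) * b" for p :: "real \<times> real"
  have [measurable]: "Y \<in> borel_measurable std_normal_pair"
    unfolding Y_def by measurable
  have law: "distr M borel X = distr std_normal_pair borel Y"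
    using law unfolding Y_def split_beta .
  have int: "has_bochner_integral std_normal_pair (\<lambda>p. of_real (f p) * c) (of_real v * c)"
    if "has_bochner_integral std_normal_pair f v" for f v and c :: complex
    using that by (intro has_bochner_integral_mult_left has_bochner_integral_of_real)
  note mom = std_normal_pair_moments
  have "has_bochner_integral std_normal_pair (\<lambda>p. of_real 1 * m + of_real (fst p) * a + of_real (snd p) * b)
     (of_real 1 * m + of_real 0 * a + of_real 0 * b)"
    by (intro has_bochner_integral_add int mom)
  then have "(\<integral>p. Y p \<partial>std_normal_pair) = m"
    by (simp add: Y_def has_bochner_integral_iff)
  moreover have "(\<integral>\<omega>. X \<omega> \<partial>M) = (\<integral>p. Y p \<partial>std_normal_pair)"
    by (rule integral_eq_of_distr_eq[OF law, where h = "\<lambda>x. x"]) auto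
  ultimately have m: "m = 0"
    using X by (simp add: standard_complex_gaussian_def)
  have Y: "Y p = of_real (fst p) * a + of_real (snd p) * b" for p
    by (simp add: Y_def m)
  have "(\<integral>\<omega>. (X \<omega>)\<^sup>2 \<partial>M) = (\<integral>\<omega>. (cis (pi / 2) * X \<omega>)\<^sup>2 \<partial>M)"
    using X unfolding standard_complex_gaussian_def circularly_symmetric_def
    by (intro integral_eq_of_distr_eq[where h = "\<lambda>x. x\<^sup>2"]) (auto simp del: cis_pi_half)
  then have "(\<integral>\<omega>. (X \<omega>)\<^sup>2 \<partial>M) = 0"
    by (simp add: power_mult_distrib)
  moreover have "(\<integral>\<omega>. (X \<omega>)\<^sup>2 \<partial>M) = (\<integral>p. (Y p)\<^sup>2 \<partial>std_normal_pair)"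
    by (rule integral_eq_of_distr_eq[OF law, where h = "\<lambda>x. x\<^sup>2"]) auto
  moreover have "has_bochner_integral std_normal_pair
     (\<lambda>p. of_real ((fst p)\<^sup>2) * a\<^sup>2 + of_real ((snd p)\<^sup>2) * b\<^sup>2 + of_real (fst p * snd p) * (2 * a * b))
     (of_real 1 * a\<^sup>2 + of_real 1 * b\<^sup>2 + of_real 0 * (2 * a * b))"
    by (intro has_bochner_integral_add int mom)
  then have "(\<integral>p. (Y p)\<^sup>2 \<partial>std_normal_pair) = a\<^sup>2 + b\<^sup>2"
    by (simp add: Y has_bochner_integral_iff power2_sum power_mult_distrib algebra_simps)
  ultimately have "a\<^sup>2 + b\<^sup>2 = 0"
    by simp
  then have "(b - \<i> * a) * (b + \<i> * a) = 0"
    by (simp add: algebra_simps power2_eq_square)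
  \<comment> \<open>The sign is left undetermined: neither the modulus nor the real part of s + i
    \<sigma> t depends on it.\<close>
  then obtain \<sigma> where \<sigma>: "\<sigma> = 1 \<or> \<sigma> = - 1" "b = \<i> * \<sigma> * a"
    using that[of 1] that[of "- 1"] by (auto simp: add_eq_0_iff2)
  define Z where "Z p = of_real (fst p) + \<i> * \<sigma> * of_real (snd p)" for p :: "real \<times> real"
  have Y: "Y p = a * Z p" for p
    by (simp add: Y \<sigma>(2) Z_def algebra_simps)
  have Z: "(cmod (Z p))\<^sup>2 = (fst p)\<^sup>2 + (snd p)\<^sup>2" for p
    using \<sigma>(1) by (auto simp: Z_def cmod_power2)
  have "(\<integral>\<omega>. (cmod (X \<omega>))\<^sup>2 \<partial>M) = (\<integral>p. (cmod (Y p))\<^sup>2 \<partial>std_normal_pair)"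
    by (rule integral_eq_of_distr_eq[OF law, where h = "\<lambda>x. (cmod x)\<^sup>2"]) auto
  also have "\<dots> = (\<integral>p. (cmod a)\<^sup>2 * ((fst p)\<^sup>2 + (snd p)\<^sup>2) \<partial>std_normal_pair)"
    by (simp add: Y norm_mult power_mult_distrib Z)
  also have "\<dots> = (cmod a)\<^sup>2 * (1 + 1)"
    by (intro has_bochner_integral_integral_eq has_bochner_integral_mult_right has_bochner_integral_add mom)
  finally have "(cmod a)\<^sup>2 = 1 / 2"
    using X by (simp add: standard_complex_gaussian_def)
  then have a: "cmod a = 1 / sqrt 2"
    using real_sqrt_unique[of "cmod a" "1 / 2"] by (simp add: real_sqrt_divide)
  have "cis (- Arg a) * rcis (cmod a) (Arg a) = of_real (cmod a)"
    by (simp add: rcis_def cis_mult mult.left_commute)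
  then have "cis (- Arg a) * a = of_real (cmod a)"
    by (simp only: rcis_cmod_Arg)
  then have rot: "cis (- Arg a) * Y p = Z p / of_real (sqrt 2)" for p
    by (simp add: Y a mult.assoc[symmetric])
  have [measurable]: "Z \<in> borel_measurable std_normal_pair"
    unfolding Z_def by measurable
  have "distr M borel X = distr M borel (\<lambda>\<omega>. cis (- Arg a) * X \<omega>)"
    using X by (simp add: standard_complex_gaussian_def circularly_symmetric_def)
  also have "\<dots> = distr std_normal_pair borel (\<lambda>p. cis (- Arg a) * Y p)"
    by (rule distr_compose_eq[OF law, where h = "\<lambda>x. cis (- Arg a) * x"]) auto
  finally show ?thesis
    using \<sigma>(1) that unfolding rot Z_def by simp
qed

text \<open>The squared modulus is half the sum of two independent squared normals, hence
  exponential with mean 1, and the integral splits into two equal one-dimensional factors. The limit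
  \<open>\<mu> < 1\<close> is the origin of the rate in the final asymptotics.\<close>

lemma standard_complex_gaussian_exp_square:
  assumes X: "standard_complex_gaussian M X" and \<mu>: "\<mu> < 1"
  shows "(\<integral>\<^sup>+\<omega>. ennreal (exp (\<mu> * (cmod (X \<omega>))\<^sup>2)) \<partial>M) = ennreal (1 / (1 - \<mu>))"
proof -
  obtain \<sigma> :: complex where \<sigma>: "\<sigma> = 1 \<or> \<sigma> = - 1" and
    law: "distr M borel X = distr std_normal_pair borel
       (\<lambda>p. (of_real (fst p) + \<i> * \<sigma> * of_real (snd p)) / of_real (sqrt 2))" (is "_ = distr _ _ ?Y")
    by (rule standard_complex_gaussian_law[OF X])
  have [measurable]: "X \<in> borel_measurable M"
    using X by (rule standard_complex_gaussian_measurable)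
  interpret pair_prob_space std_normal_distribution std_normal_distribution
    by (rule pair_prob_space_std_normal)
  have Y: "(cmod (?Y p))\<^sup>2 = ((fst p)\<^sup>2 + (snd p)\<^sup>2) / 2" for p
    using \<sigma> by (auto simp: norm_divide power_divide cmod_power2)
  let ?e = "\<lambda>s. ennreal (exp (\<mu> * s\<^sup>2 / 2))"
  have "(\<integral>\<^sup>+\<omega>. ennreal (exp (\<mu> * (cmod (X \<omega>))\<^sup>2)) \<partial>M)
      = (\<integral>\<^sup>+p. ennreal (exp (\<mu> * (cmod (?Y p))\<^sup>2)) \<partial>std_normal_pair)"
    by (rule nn_integral_eq_of_distr_eq[OF law, where h = "\<lambda>x. ennreal (exp (\<mu> * (cmod x)\<^sup>2))"]) measurable
  also have "\<dots> = (\<integral>\<^sup>+p. ?e (fst p) * ?e (snd p) \<partial>std_normal_pair)"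
    unfolding Y by (intro nn_integral_cong)
      (simp add: ennreal_mult[symmetric] exp_add[symmetric] ring_distribs add_divide_distrib)
  also have "\<dots> = (\<integral>\<^sup>+s. \<integral>\<^sup>+t. ?e s * ?e t \<partial>std_normal_distribution \<partial>std_normal_distribution)"
    by (subst M1.nn_integral_fst[symmetric]) auto
  also have "\<dots> = ennreal (1 / sqrt (1 - \<mu>)) * ennreal (1 / sqrt (1 - \<mu>))"
    by (simp add: nn_integral_cmult nn_integral_multc std_normal_nn_integral_exp_square[OF \<mu>, simplified] del: nn_integral_density)
  also have "\<dots> = ennreal (1 / (1 - \<mu>))"
    using \<mu> by (simp add: ennreal_mult[symmetric] )
  finally show ?thesis .
qed

lemma standard_complex_gaussian_Re:
  assumes X: "standard_complex_gaussian M X"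
  shows "distributed M lborel (\<lambda>\<omega>. Re (X \<omega>)) (normal_density 0 (1 / sqrt 2))"
proof -
  obtain \<sigma> :: complex where \<sigma>: "\<sigma> = 1 \<or> \<sigma> = - 1" and
    law: "distr M borel X = distr std_normal_pair borel
       (\<lambda>p. (of_real (fst p) + \<i> * \<sigma> * of_real (snd p)) / of_real (sqrt 2))" (is "_ = distr _ _ ?Y")
    by (rule standard_complex_gaussian_law[OF X])
  have [measurable]: "X \<in> borel_measurable M"
    using X by (rule standard_complex_gaussian_measurable)
  interpret pair_prob_space std_normal_distribution std_normal_distribution
    by (rule pair_prob_space_std_normal)
  have "distr M borel (\<lambda>\<omega>. Re (X \<omega>)) = distr std_normal_pair borel (\<lambda>p. Re (?Y p))"
    by (rule distr_compose_eq[OF law, where h = Re]) measurable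
  also have "(\<lambda>p. Re (?Y p)) = (\<lambda>p. fst p / sqrt 2)"
    using \<sigma> by (auto simp: fun_eq_iff)
  also have "distr std_normal_pair borel \<dots> = distr (distr std_normal_pair std_normal_distribution fst) borel (\<lambda>s. s / sqrt 2)"
    by (subst distr_distr) (auto simp: comp_def)
  also have "distr std_normal_pair std_normal_distribution fst = std_normal_distribution"
    by (simp add: M1.distr_pair_fst M1.emeasure_space_1)
  also have "distr std_normal_distribution borel (\<lambda>s. s / sqrt 2) = density lborel (normal_density 0 (1 / sqrt 2))"
  proof -
    have "distributed std_normal_distribution lborel (\<lambda>s. s) std_normal_density"
      by (simp add: distributed_def distr_id2)
    from M1.normal_density_affine[OF this, of "1 / sqrt 2" 0]
    have "distributed std_normal_distribution lborel (\<lambda>s. s / sqrt 2) (normal_density 0 (1 / sqrt 2))"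
      by simp
    then show ?thesis
      by (simp add: distributed_def cong: distr_cong)
  qed
  finally show ?thesis
    by (simp add: distributed_def cong: distr_cong)
qed

text \<open>Symmetrization: \<open>\<psi> (X)\<close> and \<open>- \<psi> (X)\<close> have the same law.\<close>

lemma standard_complex_gaussian_odd_exp_le:
  fixes \<psi> :: "complex \<Rightarrow> real"
  assumes X: "standard_complex_gaussian M X"
    and \<psi>: "\<psi> \<in> borel_measurable borel" "\<And>w. \<psi> (- w) = - \<psi> w" "\<And>w. \<bar>\<psi> w\<bar> \<le> c * cmod w"
    and c: "c \<ge> 0"
  shows "(\<integral>\<^sup>+\<omega>. ennreal (exp (\<psi> (X \<omega>))) \<partial>M) \<le> ennreal (exp (2 * c\<^sup>2))"
proof (cases "c\<^sup>2 \<le> 1 / 2")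
  \<comment> \<open>Averaging over the sign of X turns the odd exponent into cosh, which is at most
    the exponential of the square. The resulting moment of
    \<open>c\<^sup>2 * (cmod (X \<omega>))\<^sup>2\<close> is 1 / (1 - c^2), and for c^2 at most 1/2
    this lies below exp(2 c^2).\<close>
  case True
  have [measurable]: "X \<in> borel_measurable M"
    using X by (rule standard_complex_gaussian_measurable)
  note \<psi>(1)[measurable]
  have "distr M borel (\<lambda>\<omega>. cis pi * X \<omega>) = distr M borel X"
    using X unfolding standard_complex_gaussian_def circularly_symmetric_def by blast
  then have sym: "distr M borel X = distr M borel (\<lambda>\<omega>. - X \<omega>)"
    by simp
  let ?I = "\<integral>\<^sup>+\<omega>. ennreal (exp (\<psi> (X \<omega>))) \<partial>M"
  have "?I = (\<integral>\<^sup>+\<omega>. ennreal (exp (\<psi> (- X \<omega>))) \<partial>M)"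
    by (rule nn_integral_eq_of_distr_eq[OF sym, where h = "\<lambda>w. ennreal (exp (\<psi> w))"]) measurable
  then have "2 * ?I = ?I + (\<integral>\<^sup>+\<omega>. ennreal (exp (\<psi> (- X \<omega>))) \<partial>M)"
    by (simp add: mult_2)
  also have "\<dots> = (\<integral>\<^sup>+\<omega>. ennreal (exp (\<psi> (X \<omega>)) + exp (- \<psi> (X \<omega>))) \<partial>M)"
    by (subst nn_integral_add[symmetric]) (auto simp: \<psi>(2))
  also have "\<dots> \<le> (\<integral>\<^sup>+\<omega>. 2 * ennreal (exp (c\<^sup>2 * (cmod (X \<omega>))\<^sup>2)) \<partial>M)"
  proof (intro nn_integral_mono)
    fix \<omega>
    have "(\<psi> (X \<omega>))\<^sup>2 \<le> (c * cmod (X \<omega>))\<^sup>2"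
      using \<psi>(3)[of "X \<omega>"] by (simp add: abs_le_square_iff[symmetric])
    then have "exp ((\<psi> (X \<omega>))\<^sup>2) \<le> exp (c\<^sup>2 * (cmod (X \<omega>))\<^sup>2)"
      by (simp add: power_mult_distrib)
    then have "exp (\<psi> (X \<omega>)) + exp (- \<psi> (X \<omega>)) \<le> 2 * exp (c\<^sup>2 * (cmod (X \<omega>))\<^sup>2)"
      using exp_add_exp_neg_le[of "\<psi> (X \<omega>)"] by linarith
    then have "ennreal (exp (\<psi> (X \<omega>)) + exp (- \<psi> (X \<omega>))) \<le> ennreal (2 * exp (c\<^sup>2 * (cmod (X \<omega>))\<^sup>2))"
      by (rule ennreal_leI)
    then show "ennreal (exp (\<psi> (X \<omega>)) + exp (- \<psi> (X \<omega>))) \<le> 2 * ennreal (exp (c\<^sup>2 * (cmod (X \<omega>))\<^sup>2))"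
      by (simp add: ennreal_mult)
  qed
  also have "\<dots> = 2 * ennreal (1 / (1 - c\<^sup>2))"
    using True by (simp add: nn_integral_cmult standard_complex_gaussian_exp_square[OF X])
  finally have "?I \<le> ennreal (1 / (1 - c\<^sup>2))"
    by (simp add: ennreal_mult_le_mult_iff)
  also have "1 / (1 - c\<^sup>2) \<le> exp (2 * c\<^sup>2)"
  proof -
    have "0 \<le> c\<^sup>2 * (1 - 2 * c\<^sup>2)"
      using True by (intro mult_nonneg_nonneg) auto
    then have "1 \<le> (1 + 2 * c\<^sup>2) * (1 - c\<^sup>2)"
      by (simp add: algebra_simps)
    also have "\<dots> \<le> exp (2 * c\<^sup>2) * (1 - c\<^sup>2)"
      using True by (intro mult_right_mono exp_ge_add_one_self) auto
    finally show ?thesis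
      using True by (simp add: field_simps)
  qed
  finally show ?thesis by (simp add: ennreal_leI)
next
  \<comment> \<open>For large c the crude inequality c |w| <= c^2 + |w|^2 / 4 suffices: the
    remaining moment 4/3 is at most 1 + c^2 and is absorbed into a second factor exp(c^2).\<close>
  case False
  have [measurable]: "X \<in> borel_measurable M"
    using X by (rule standard_complex_gaussian_measurable)
  have "(\<integral>\<^sup>+\<omega>. ennreal (exp (\<psi> (X \<omega>))) \<partial>M)
      \<le> (\<integral>\<^sup>+\<omega>. ennreal (exp (c\<^sup>2)) * ennreal (exp (1 / 4 * (cmod (X \<omega>))\<^sup>2)) \<partial>M)"
  proof (intro nn_integral_mono)
    fix \<omega>
    have "0 \<le> (c - cmod (X \<omega>) / 2)\<^sup>2"
      by simp
    then have "c * cmod (X \<omega>) \<le> c\<^sup>2 + 1 / 4 * (cmod (X \<omega>))\<^sup>2"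
      by (simp add: power2_diff power_divide)
    then have "exp (\<psi> (X \<omega>)) \<le> exp (c\<^sup>2 + 1 / 4 * (cmod (X \<omega>))\<^sup>2)"
      using \<psi>(3)[of "X \<omega>"] by simp
    then show "ennreal (exp (\<psi> (X \<omega>))) \<le> ennreal (exp (c\<^sup>2)) * ennreal (exp (1 / 4 * (cmod (X \<omega>))\<^sup>2))"
      by (simp add: ennreal_mult[symmetric] exp_add[symmetric] ennreal_leI)
  qed
  also have "\<dots> = ennreal (exp (c\<^sup>2)) * ennreal (4 / 3)"
    using standard_complex_gaussian_exp_square[OF X, of "1 / 4"] by (simp add: nn_integral_cmult)
  also have "\<dots> \<le> ennreal (exp (c\<^sup>2)) * ennreal (exp (c\<^sup>2))"
  proof (intro mult_left_mono ennreal_leI)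
    have "4 / 3 \<le> 1 + c\<^sup>2"
      using False by simp
    then show "4 / 3 \<le> exp (c\<^sup>2)"
      using exp_ge_add_one_self[of "c\<^sup>2"] by linarith
  qed auto
  also have "\<dots> = ennreal (exp (2 * c\<^sup>2))"
    by (simp add: ennreal_mult[symmetric] exp_add[symmetric])
  finally show ?thesis .
qed

section \<open>Independent Gaussian families\<close>

locale gaussian_family = prob_space M for M :: "'a measure" +
  fixes g :: "int \<Rightarrow> 'a \<Rightarrow> complex"
  assumes indep: "indep_vars (\<lambda>_. borel) g UNIV"
    and gaussian: "\<And>n. standard_complex_gaussian M (g n)"
begin

lemma g_measurable [measurable]: "g n \<in> borel_measurable M"
  using gaussian by (rule standard_complex_gaussian_measurable)

lemma nn_integral_exp_sum:
  fixes \<psi> :: "int \<Rightarrow> complex \<Rightarrow> real"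
  assumes "finite A" and [measurable]: "\<And>n. \<psi> n \<in> borel_measurable borel"
  shows "(\<integral>\<^sup>+\<omega>. ennreal (exp (\<Sum>n\<in>A. \<psi> n (g n \<omega>))) \<partial>M) = (\<Prod>n\<in>A. \<integral>\<^sup>+\<omega>. ennreal (exp (\<psi> n (g n \<omega>))) \<partial>M)"
proof -
  have "(\<integral>\<^sup>+\<omega>. ennreal (exp (\<Sum>n\<in>A. \<psi> n (g n \<omega>))) \<partial>M)
      = (\<integral>\<^sup>+\<omega>. (\<Prod>n\<in>A. ennreal (exp (\<psi> n (g n \<omega>)))) \<partial>M)"
    using assms by (simp add: exp_sum prod_ennreal)
  also have "\<dots> = (\<Prod>n\<in>A. \<integral>\<^sup>+\<omega>. ennreal (exp (\<psi> n (g n \<omega>))) \<partial>M)"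
    by (intro indep_vars_nn_integral \<open>finite A\<close> indep_vars_compose2[OF indep_vars_subset[OF indep]]) auto
  finally show ?thesis .
qed

text \<open>A Chernoff bound with the usual Gaussian shape, although the \<psi> n may be nonlinear:
  oddness and linear growth already give each summand a subgaussian exponential moment.\<close>

lemma odd_sum_tail:
  fixes \<psi> :: "int \<Rightarrow> complex \<Rightarrow> real"
  assumes A: "finite A" and \<psi>: "\<And>n. \<psi> n \<in> borel_measurable borel" "\<And>n w. \<psi> n (- w) = - \<psi> n w"
      "\<And>n w. \<bar>\<psi> n w\<bar> \<le> c n * cmod w" "\<And>n. c n \<ge> 0"
    and s: "(\<Sum>n\<in>A. (c n)\<^sup>2) \<le> s" "s > 0" and r: "r > 0"
  shows "prob {\<omega> \<in> space M. r \<le> (\<Sum>n\<in>A. \<psi> n (g n \<omega>))} \<le> exp (- (r\<^sup>2 / (8 * s)))"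
proof -
  note \<psi>(1)[measurable]
  \<comment> \<open>The minimizer of \<open>- l * r + 2 * l\<^sup>2 * s\<close>.\<close>
  define l where "l = r / (4 * s)"
  have l: "l > 0"
    using r s by (simp add: l_def)
  have "ennreal (prob {\<omega> \<in> space M. r \<le> (\<Sum>n\<in>A. \<psi> n (g n \<omega>))})
      \<le> ennreal (exp (- l * r)) * (\<integral>\<^sup>+\<omega>\<in>space M. ennreal (exp (l * (\<Sum>n\<in>A. \<psi> n (g n \<omega>)))) \<partial>M)"
    unfolding emeasure_eq_measure[symmetric] by (intro Chernoff_ineq_nn_integral_ge l) auto
  also have "(\<integral>\<^sup>+\<omega>\<in>space M. ennreal (exp (l * (\<Sum>n\<in>A. \<psi> n (g n \<omega>)))) \<partial>M)
      = (\<integral>\<^sup>+\<omega>. ennreal (exp (\<Sum>n\<in>A. l * \<psi> n (g n \<omega>))) \<partial>M)"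
    by (intro nn_integral_cong) (simp add: sum_distrib_left)
  also have "\<dots> = (\<Prod>n\<in>A. \<integral>\<^sup>+\<omega>. ennreal (exp (l * \<psi> n (g n \<omega>))) \<partial>M)"
    by (rule nn_integral_exp_sum[OF A, where \<psi> = "\<lambda>n w. l * \<psi> n w"]) measurable
  also have "\<dots> \<le> (\<Prod>n\<in>A. ennreal (exp (2 * (l * c n)\<^sup>2)))"
    using l \<psi> by (intro prod_mono_ennreal standard_complex_gaussian_odd_exp_le[OF gaussian, where \<psi> = "\<lambda>w. l * \<psi> _ w"])
      (auto simp: abs_mult mult.assoc intro!: mult_left_mono)
  also have "\<dots> = ennreal (exp (2 * l\<^sup>2 * (\<Sum>n\<in>A. (c n)\<^sup>2)))"
    using A by (simp add: prod_ennreal exp_sum[symmetric] sum_distrib_left power_mult_distrib mult.assoc)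
  also have "\<dots> \<le> ennreal (exp (2 * l\<^sup>2 * s))"
    using s by (intro ennreal_leI) (auto intro: mult_left_mono)
  also have "ennreal (exp (- l * r)) * ennreal (exp (2 * l\<^sup>2 * s)) = ennreal (exp (- l * r + 2 * l\<^sup>2 * s))"
    by (simp only: exp_add) (simp add: ennreal_mult[symmetric])
  also have "- l * r + 2 * l\<^sup>2 * s = - (r\<^sup>2 / (8 * s))"
    using s by (simp add: l_def power2_eq_square field_simps)
  finally show ?thesis
    by (simp add: mult_left_mono)
qed

text \<open>If Re, -Re, Im and -Im of the sum all stay below r / sqrt 2, its modulus stays below r.
  Each of the four is a sum of odd real functions of the Gaussians, and the real bound at r / sqrt 2
  doubles the 8 in the exponent to 16.\<close>

lemma complex_odd_sum_tail:
  fixes \<phi> :: "int \<Rightarrow> complex \<Rightarrow> complex"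
  assumes A: "finite A" and \<phi>: "\<And>n. \<phi> n \<in> borel_measurable borel" "\<And>n w. \<phi> n (- w) = - \<phi> n w"
      "\<And>n w. cmod (\<phi> n w) \<le> c n * cmod w" "\<And>n. c n \<ge> 0"
    and s: "(\<Sum>n\<in>A. (c n)\<^sup>2) \<le> s" "s > 0" and r: "r > 0"
  shows "prob {\<omega> \<in> space M. r \<le> cmod (\<Sum>n\<in>A. \<phi> n (g n \<omega>))} \<le> 4 * exp (- (r\<^sup>2 / (16 * s)))"
proof -
  note \<phi>(1)[measurable]
  define q where "q = r / sqrt 2"
  have q: "q > 0" "q\<^sup>2 = r\<^sup>2 / 2"
    using r by (auto simp: q_def power_divide)
  let ?E = "\<lambda>h. {\<omega> \<in> space M. q \<le> (\<Sum>n\<in>A. h (\<phi> n (g n \<omega>)))}"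
  have E: "prob (?E h) \<le> exp (- (r\<^sup>2 / (16 * s)))"
    if h [measurable]: "h \<in> borel_measurable borel" and h': "\<And>w. h (- w) = - h w" "\<And>w. \<bar>h w\<bar> \<le> cmod w" for h
  proof -
    have "prob (?E h) \<le> exp (- (q\<^sup>2 / (8 * s)))"
      using h' \<phi> by (intro odd_sum_tail[OF A, where \<psi> = "\<lambda>n w. h (\<phi> n w)" and c = c] s q)
        (auto intro: order_trans[OF h'(2)])
    then show ?thesis by (simp add: q)
  qed
  have "{\<omega> \<in> space M. r \<le> cmod (\<Sum>n\<in>A. \<phi> n (g n \<omega>))}
      \<subseteq> (?E Re \<union> ?E (\<lambda>w. - Re w)) \<union> (?E Im \<union> ?E (\<lambda>w. - Im w))"
  proof (intro subsetI, rule ccontr)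
    fix \<omega> assume "\<omega> \<in> {\<omega> \<in> space M. r \<le> cmod (\<Sum>n\<in>A. \<phi> n (g n \<omega>))}"
    then have \<omega>: "\<omega> \<in> space M" "r \<le> cmod (\<Sum>n\<in>A. \<phi> n (g n \<omega>))"
      by auto
    define z where "z = (\<Sum>n\<in>A. \<phi> n (g n \<omega>))"
    assume "\<omega> \<notin> (?E Re \<union> ?E (\<lambda>w. - Re w)) \<union> (?E Im \<union> ?E (\<lambda>w. - Im w))"
    with \<omega> have "\<bar>Re z\<bar> < q" "\<bar>Im z\<bar> < q"
      by (auto simp: z_def sum_negf Re_sum Im_sum)
    then have "(Re z)\<^sup>2 < q\<^sup>2" "(Im z)\<^sup>2 < q\<^sup>2"
      using q(1) by (auto intro!: power2_strict_mono)
    then have "(cmod z)\<^sup>2 < r\<^sup>2"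
      by (simp add: cmod_power2 q)
    moreover have "r\<^sup>2 \<le> (cmod z)\<^sup>2"
      using \<omega>(2) r unfolding z_def by (intro power_mono) auto
    ultimately show False by simp
  qed
  then have "prob {\<omega> \<in> space M. r \<le> cmod (\<Sum>n\<in>A. \<phi> n (g n \<omega>))}
      \<le> prob ((?E Re \<union> ?E (\<lambda>w. - Re w)) \<union> (?E Im \<union> ?E (\<lambda>w. - Im w)))"
    by (intro finite_measure_mono) auto
  also have "\<dots> \<le> (prob (?E Re) + prob (?E (\<lambda>w. - Re w))) + (prob (?E Im) + prob (?E (\<lambda>w. - Im w)))"
    by (intro order_trans[OF measure_Un_le] add_mono measure_Un_le) auto
  also have "\<dots> \<le> 4 * exp (- (r\<^sup>2 / (16 * s)))"
    using E[of Re] E[of "\<lambda>w. - Re w"] E[of Im] E[of "\<lambda>w. - Im w"] abs_Re_le_cmod abs_Im_le_cmod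
    by simp
  finally show ?thesis .
qed

text \<open>The rate \<mu> can be brought as close to 1 as desired. The price is a prefactor
  exponential in the number of frequencies, but that number is fixed while r grows like
  1/eps.\<close>

lemma square_sum_tail:
  assumes A: "finite A" and \<mu>: "0 < \<mu>" "\<mu> < 1"
  shows "prob {\<omega> \<in> space M. r \<le> (\<Sum>n\<in>A. (cmod (g n \<omega>))\<^sup>2)} \<le> exp (- \<mu> * r) * (1 / (1 - \<mu>)) ^ card A"
proof -
  have "ennreal (prob {\<omega> \<in> space M. r \<le> (\<Sum>n\<in>A. (cmod (g n \<omega>))\<^sup>2)})
      \<le> ennreal (exp (- \<mu> * r)) * (\<integral>\<^sup>+\<omega>\<in>space M. ennreal (exp (\<mu> * (\<Sum>n\<in>A. (cmod (g n \<omega>))\<^sup>2))) \<partial>M)"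
    unfolding emeasure_eq_measure[symmetric] by (intro Chernoff_ineq_nn_integral_ge \<mu>) auto
  also have "(\<integral>\<^sup>+\<omega>\<in>space M. ennreal (exp (\<mu> * (\<Sum>n\<in>A. (cmod (g n \<omega>))\<^sup>2))) \<partial>M)
      = (\<integral>\<^sup>+\<omega>. ennreal (exp (\<Sum>n\<in>A. \<mu> * (cmod (g n \<omega>))\<^sup>2)) \<partial>M)"
    by (intro nn_integral_cong) (simp add: sum_distrib_left)
  also have "\<dots> = (\<Prod>n\<in>A. \<integral>\<^sup>+\<omega>. ennreal (exp (\<mu> * (cmod (g n \<omega>))\<^sup>2)) \<partial>M)"
    by (rule nn_integral_exp_sum[OF A, where \<psi> = "\<lambda>n w. \<mu> * (cmod w)\<^sup>2"]) measurable
  also have "\<dots> = ennreal ((1 / (1 - \<mu>)) ^ card A)"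
    using \<mu> by (simp only: standard_complex_gaussian_exp_square[OF gaussian \<mu>(2)] prod_constant) (simp add: ennreal_power)
  finally show ?thesis
    using \<mu> by (simp add: ennreal_mult[symmetric])
qed

lemma gaussian_tail:
  "prob {\<omega> \<in> space M. r \<le> cmod (g n \<omega>)} \<le> 2 * exp (- (r\<^sup>2 / 2))" if "r \<ge> 0"
proof -
  have "{\<omega> \<in> space M. r \<le> cmod (g n \<omega>)} = {\<omega> \<in> space M. r\<^sup>2 \<le> (\<Sum>n\<in>{n}. (cmod (g n \<omega>))\<^sup>2)}"
    using that by (auto simp: power2_le_iff_abs_le)
  then show ?thesis
    using square_sum_tail[of "{n}" "1 / 2" "r\<^sup>2"] by (simp add: mult.commute)
qed

text \<open>The real part is normal with variance s / 2, and on the unit window above y its density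
  is at least the value at y + 1. Replacing y by y + 1 is negligible once y is of order
  eps^(-1/2).\<close>

lemma Re_sum_lower_tail:
  assumes A: "finite A" "A \<noteq> {}" and c: "\<And>n. n \<in> A \<Longrightarrow> c n > 0" and s: "s = (\<Sum>n\<in>A. (c n)\<^sup>2)" and y: "y \<ge> 0"
  shows "exp (- ((y + 1)\<^sup>2 / s)) / sqrt (pi * s) \<le> prob {\<omega> \<in> space M. y < Re (\<Sum>n\<in>A. of_real (c n) * g n \<omega>)}"
proof -
  have s0: "s > 0"
    using A c unfolding s by (intro sum_pos zero_less_power) auto
  have "distributed M lborel (\<lambda>\<omega>. \<Sum>n\<in>A. c n * Re (g n \<omega>)) (normal_density (\<Sum>n\<in>A. 0) (sqrt (\<Sum>n\<in>A. (c n / sqrt 2)\<^sup>2)))"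
  proof (intro sum_indep_normal A)
    show "indep_vars (\<lambda>_. borel) (\<lambda>n \<omega>. c n * Re (g n \<omega>)) A"
      by (rule indep_vars_compose2[OF indep_vars_subset[OF indep]]) auto
    fix n assume n: "n \<in> A"
    show "0 < c n / sqrt 2"
      using c[OF n] by simp
    show "distributed M lborel (\<lambda>\<omega>. c n * Re (g n \<omega>)) (normal_density 0 (c n / sqrt 2))"
      using normal_density_affine[OF standard_complex_gaussian_Re[OF gaussian], of "c n" 0 n] c[OF n] by simp
  qed
  also have "sqrt (\<Sum>n\<in>A. (c n / sqrt 2)\<^sup>2) = sqrt (s / 2)"
    by (simp add: s power_divide sum_divide_distrib)
  finally have D: "distributed M lborel (\<lambda>\<omega>. \<Sum>n\<in>A. c n * Re (g n \<omega>)) (normal_density 0 (sqrt (s / 2)))"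
    by simp
  have "ennreal (exp (- ((y + 1)\<^sup>2 / s)) / sqrt (pi * s))
      = (\<integral>\<^sup>+x. ennreal (exp (- ((y + 1)\<^sup>2 / s)) / sqrt (pi * s)) * indicator {y<..y + 1} x \<partial>lborel)"
    by (simp add: nn_integral_cmult_indicator)
  also have "\<dots> \<le> (\<integral>\<^sup>+x. ennreal (normal_density 0 (sqrt (s / 2)) x) * indicator {y<..} x \<partial>lborel)"
  proof (intro nn_integral_mono)
    fix x :: real
    have "exp (- ((y + 1)\<^sup>2 / s)) / sqrt (pi * s) \<le> normal_density 0 (sqrt (s / 2)) x" if "x \<in> {y<..y + 1}"
      using that y s0 by (auto simp: normal_density_def intro!: divide_right_mono power_mono)
    then show "ennreal (exp (- ((y + 1)\<^sup>2 / s)) / sqrt (pi * s)) * indicator {y<..y + 1} x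
        \<le> ennreal (normal_density 0 (sqrt (s / 2)) x) * indicator {y<..} x"
      by (auto simp: indicator_def ennreal_leI)
  qed
  also have "\<dots> = emeasure M ((\<lambda>\<omega>. \<Sum>n\<in>A. c n * Re (g n \<omega>)) -` {y<..} \<inter> space M)"
    by (rule distributed_emeasure[OF D, symmetric]) simp
  also have "(\<lambda>\<omega>. \<Sum>n\<in>A. c n * Re (g n \<omega>)) -` {y<..} \<inter> space M
      = {\<omega> \<in> space M. y < Re (\<Sum>n\<in>A. of_real (c n) * g n \<omega>)}"
    by (auto simp: Re_sum)
  finally show ?thesis
    by (simp add: emeasure_eq_measure)
qed

end

section \<open>Coefficients and dyadic blocks\<close>

lemma coeff_c_pos: "coeff_c \<theta> n > 0"
proof -
  have "1 + \<bar>real_of_int n\<bar>\<^sup>2 > 0"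
    by (simp add: add_pos_nonneg)
  then show ?thesis
    by (simp add: coeff_c_def japanese_bracket_def)
qed

lemma coeff_c_0 [simp]: "coeff_c \<theta> 0 = 1"
  by (simp add: coeff_c_def japanese_bracket_def)

lemma coeff_c_square: "(coeff_c \<theta> n)\<^sup>2 = (1 + (real_of_int n)\<^sup>2) powr (- (1 / 2 + \<theta>))"
proof -
  have "1 + (real_of_int n)\<^sup>2 > 0"
    by (simp add: add_pos_nonneg)
  then show ?thesis
    by (simp add: coeff_c_def japanese_bracket_def powr_powr diff_divide_distrib flip: powr_realpow)
qed

lemma coeff_c_le_1:
  assumes "\<theta> > 0"
  shows "coeff_c \<theta> n \<le> 1"
proof -
  have "(coeff_c \<theta> n)\<^sup>2 \<le> (1 + (real_of_int n)\<^sup>2) powr 0"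
    unfolding coeff_c_square using assms by (intro powr_mono) auto
  also have "\<dots> \<le> 1\<^sup>2"
    by simp
  finally show ?thesis
    by (rule power2_le_imp_le) simp
qed

text \<open>The strict inequality makes \<open>freq (2 ^ Suc k) - freq (2 ^ k)\<close> the dyadic block
  \<open>2\<^sup>k \<le> \<bar>n\<bar> < 2\<^sup>k\<^sup>+\<^sup>1\<close>; the symmetric partial sum up to \<open>N\<close> runs over \<open>freq (Suc N)\<close>.\<close>

definition freq :: "nat \<Rightarrow> int set" where
  "freq m = {n. \<bar>n\<bar> < int m}"

lemma freq_Suc: "freq (Suc N) = {- int N..int N}"
  by (auto simp: freq_def)

lemma freq_eq: "freq m = {- int m<..<int m}"
  by (auto simp: freq_def)

lemma finite_freq [simp]: "finite (freq m)"
  by (simp add: freq_eq)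

lemma card_freq_le: "card (freq m) \<le> 2 * m"
  by (simp add: freq_eq)

lemma freq_mono: "m \<le> m' \<Longrightarrow> freq m \<subseteq> freq m'"
  by (auto simp: freq_def)

text \<open>The coefficient mass of the \<open>k\<close>-th dyadic block is of order \<open>rho \<theta> ^ (4 * k)\<close>, so the blocks can be
  allotted thresholds proportional to \<open>rho \<theta> ^ k\<close>, which are summable and still far above the
  standard deviation \<open>rho \<theta> ^ (2 * k)\<close>.\<close>

definition rho :: "real \<Rightarrow> real" where
  "rho \<theta> = 2 powr (- \<theta> / 2)"

lemma rho_bounds: "\<theta> > 0 \<Longrightarrow> 0 < rho \<theta>" "\<theta> > 0 \<Longrightarrow> rho \<theta> < 1"
  using powr_less_mono[of "- \<theta> / 2" 0 2] by (auto simp: rho_def)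

text \<open>For |n| at least 2^k the square is at most 2^(-k) 2^(-2 \<theta> k). The first factor is
  split off because it cancels the number of frequencies in a block; the second is
  \<open>rho \<theta> ^ (4 * k)\<close>.\<close>

lemma coeff_c_square_le:
  assumes "\<theta> > 0" and n: "n \<notin> freq (2 ^ k)"
  shows "(coeff_c \<theta> n)\<^sup>2 \<le> rho \<theta> ^ (4 * k) / 2 ^ k"
proof -
  have "int (2 ^ k) \<le> \<bar>n\<bar>"
    using n by (auto simp: freq_def)
  then have "real_of_int (int (2 ^ k)) \<le> real_of_int \<bar>n\<bar>"
    by (simp only: of_int_le_iff)
  then have "(2 ^ k)\<^sup>2 \<le> (real_of_int \<bar>n\<bar>)\<^sup>2"
    by (intro power_mono) auto
  then have "(2 powr (2 * real k)) \<le> 1 + (real_of_int n)\<^sup>2"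
    by (simp add: powr_realpow[symmetric] powr_powr mult.commute power_mult[symmetric] flip: powr_power)
  then have "(coeff_c \<theta> n)\<^sup>2 \<le> (2 powr (2 * real k)) powr (- (1 / 2 + \<theta>))"
    unfolding coeff_c_square using assms by (intro powr_mono2') auto
  also have "\<dots> = 2 powr (- 2 * \<theta> * k) / 2 powr k"
    by (simp add: powr_powr powr_diff[symmetric] algebra_simps)
  also have "\<dots> = rho \<theta> ^ (4 * k) / 2 ^ k"
    by (simp add: rho_def powr_powr powr_realpow[symmetric] mult_ac)
  finally show ?thesis .
qed

text \<open>Stated for arbitrary parts \<open>A\<close> of a block, since partial sums that end
  inside a block have to be controlled as well.\<close>

lemma sum_coeff_c_square_block:
  assumes "\<theta> > 0" and A: "A \<subseteq> freq (2 ^ Suc k) - freq (2 ^ k)"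
  shows "(\<Sum>n\<in>A. (coeff_c \<theta> n)\<^sup>2) \<le> 4 * rho \<theta> ^ (4 * k)"
proof -
  have "card A \<le> card (freq (2 ^ Suc k))"
    using A by (intro card_mono) auto
  then have card: "card A \<le> 4 * 2 ^ k"
    using card_freq_le[of "2 ^ Suc k"] by simp
  have "(\<Sum>n\<in>A. (coeff_c \<theta> n)\<^sup>2) \<le> real (card A) * (rho \<theta> ^ (4 * k) / 2 ^ k)"
    using A by (intro sum_bounded_above coeff_c_square_le assms) auto
  also have "\<dots> \<le> real (4 * 2 ^ k) * (rho \<theta> ^ (4 * k) / 2 ^ k)"
    using card rho_bounds[OF assms(1)] by (intro mult_right_mono) (auto simp only: of_nat_le_iff, auto)
  finally show ?thesis by simp
qed

lemma coeff_c_square_summable: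
  assumes "\<theta> > 0"
  shows "(\<lambda>n. (coeff_c \<theta> n)\<^sup>2) summable_on UNIV"
proof (rule nonneg_bdd_above_summable_on)
  define q where "q = rho \<theta> ^ 4"
  have q: "0 < q" "q < 1"
    using rho_bounds[OF assms] by (auto simp: q_def power_less_one_iff)
  have *: "(\<Sum>n\<in>freq (2 ^ k). (coeff_c \<theta> n)\<^sup>2) \<le> 1 + 4 * (\<Sum>j<k. q ^ j)" for k
  proof (induction k)
    case 0
    have "freq 1 = {0}"
      by (auto simp: freq_def)
    then show ?case by simp
  next
    case (Suc k)
    have "(\<Sum>n\<in>freq (2 ^ Suc k). (coeff_c \<theta> n)\<^sup>2)
        = (\<Sum>n\<in>freq (2 ^ Suc k) - freq (2 ^ k). (coeff_c \<theta> n)\<^sup>2) + (\<Sum>n\<in>freq (2 ^ k). (coeff_c \<theta> n)\<^sup>2)"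
      by (intro sum.subset_diff freq_mono) auto
    with Suc sum_coeff_c_square_block[OF assms order_refl, of k] show ?case
      by (simp add: q_def power_mult[symmetric] algebra_simps)
  qed
  have "(\<Sum>n\<in>F. (coeff_c \<theta> n)\<^sup>2) \<le> 1 + 4 * (1 / (1 - q))" if F: "finite F" for F
  proof -
    obtain K where K: "\<forall>n\<in>F. nat \<bar>n\<bar> \<le> K"
      using finite_nat_set_iff_bounded_le[of "(\<lambda>n. nat \<bar>n\<bar>) ` F"] F by auto
    have "F \<subseteq> freq (2 ^ K)"
    proof
      fix n assume "n \<in> F"
      then have "nat \<bar>n\<bar> < 2 ^ K"
        using K less_exp[of K] by (metis le_less_trans)
      then show "n \<in> freq (2 ^ K)"
        by (simp add: freq_def zless_nat_eq_int_zless nat_less_iff)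
    qed
    then have "(\<Sum>n\<in>F. (coeff_c \<theta> n)\<^sup>2) \<le> (\<Sum>n\<in>freq (2 ^ K). (coeff_c \<theta> n)\<^sup>2)"
      by (intro sum_mono2) auto
    also have "\<dots> \<le> 1 + 4 * (\<Sum>j<K. q ^ j)"
      by (rule *)
    also have "(\<Sum>j<K. q ^ j) \<le> (\<Sum>j. q ^ j)"
      using q by (intro sum_le_suminf summable_geometric) auto
    also have "\<dots> = 1 / (1 - q)"
      using q by (intro suminf_geometric) auto
    finally show ?thesis by simp
  qed
  then show "bdd_above (sum (\<lambda>n. (coeff_c \<theta> n)\<^sup>2) ` {F. F \<subseteq> UNIV \<and> finite F})"
    by (intro bdd_aboveI[of _ "1 + 4 * (1 / (1 - q))"]) auto
qed auto

definition mass :: "real \<Rightarrow> real" where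
  "mass \<theta> = (\<Sum>\<^sub>\<infinity>n\<in>UNIV. (coeff_c \<theta> n)\<^sup>2)"

lemma sum_coeff_c_le_mass:
  assumes "\<theta> > 0" "finite A"
  shows "(\<Sum>n\<in>A. (coeff_c \<theta> n)\<^sup>2) \<le> mass \<theta>"
  unfolding mass_def using coeff_c_square_summable assms by (intro finite_sum_le_infsum) auto

lemma mass_ge_1: "\<theta> > 0 \<Longrightarrow> mass \<theta> \<ge> 1"
  using sum_coeff_c_le_mass[of \<theta> "{0}"] by simp

lemma freq_sum_tendsto_mass:
  assumes "\<theta> > 0"
  shows "(\<lambda>k. \<Sum>n\<in>freq (2 ^ k). (coeff_c \<theta> n)\<^sup>2) \<longlonglongrightarrow> mass \<theta>"
proof -
  have "filterlim (\<lambda>k. freq (2 ^ k)) (finite_subsets_at_top UNIV) sequentially"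
    unfolding filterlim_finite_subsets_at_top
  proof (intro allI impI)
    fix X :: "int set" assume X: "finite X \<and> X \<subseteq> UNIV"
    then obtain K where K: "\<forall>n\<in>X. nat \<bar>n\<bar> \<le> K"
      using finite_nat_set_iff_bounded_le[of "(\<lambda>n. nat \<bar>n\<bar>) ` X"] by auto
    show "\<forall>\<^sub>F k in sequentially. finite (freq (2 ^ k)) \<and> X \<subseteq> freq (2 ^ k) \<and> freq (2 ^ k) \<subseteq> UNIV"
      using eventually_ge_at_top[of K]
    proof eventually_elim
      case (elim k)
      have "n \<in> freq (2 ^ k)" if "n \<in> X" for n
      proof -
        have "nat \<bar>n\<bar> < 2 ^ k"
          using K elim that less_exp[of k] by (metis le_less_trans le_trans)
        then show ?thesis
          by (simp add: freq_def nat_less_iff)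
      qed
      then show ?case by auto
    qed
  qed
  then show ?thesis
    unfolding mass_def by (rule filterlim_compose[OF infsum_tendsto[OF coeff_c_square_summable[OF assms]]])
qed

section \<open>Oscillation of the wave sums in space and time, and dyadic convergence\<close>

lemma cmod_exp_i_diff_le: "cmod (exp (\<i> * of_real a) - exp (\<i> * of_real b)) \<le> \<bar>a - b\<bar>"
proof -
  have "exp (\<i> * of_real a) - exp (\<i> * of_real b) = exp (\<i> * of_real b) * (exp (\<i> * of_real (a - b)) - 1)"
    by (simp add: algebra_simps exp_add[symmetric])
  then have "cmod (exp (\<i> * of_real a) - exp (\<i> * of_real b)) = cmod (exp (\<i> * of_real (a - b)) - 1)"
    by (simp add: norm_mult)
  also have "\<dots> \<le> \<bar>a - b\<bar>"
    using iexp_approx1[of "a - b" 0] by simp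
  finally show ?thesis .
qed

text \<open>The Gaussian value \<open>w\<close> is an argument, so that each term of the series is a
  deterministic function applied to \<open>g n\<close>. It enters only through its modulus, which
  keeps \<open>wave\<close> odd in \<open>w\<close>.\<close>

definition phase :: "real \<Rightarrow> real \<Rightarrow> real \<Rightarrow> real \<Rightarrow> int \<Rightarrow> complex \<Rightarrow> real" where
  "phase \<theta> \<epsilon> t x n w = real_of_int n * x + t * (\<epsilon>\<^sup>2 * (coeff_c \<theta> n)\<^sup>2 * (cmod w)\<^sup>2 - (real_of_int n)\<^sup>2)"

definition wave :: "real \<Rightarrow> real \<Rightarrow> real \<Rightarrow> real \<Rightarrow> int \<Rightarrow> complex \<Rightarrow> complex" where
  "wave \<theta> \<epsilon> t x n w = of_real (coeff_c \<theta> n) * w * exp (\<i> * of_real (phase \<theta> \<epsilon> t x n w))"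

lemma cmod_wave: "cmod (wave \<theta> \<epsilon> t x n w) = coeff_c \<theta> n * cmod w"
  using coeff_c_pos[of \<theta> n] by (simp add: wave_def norm_mult)

lemma wave_minus: "wave \<theta> \<epsilon> t x n (- w) = - wave \<theta> \<epsilon> t x n w"
  by (simp add: wave_def phase_def)

lemma wave_measurable: "wave \<theta> \<epsilon> t x n \<in> borel_measurable borel"
  unfolding wave_def phase_def by measurable

text \<open>Valid for every \<open>G\<close>, whether or not the series converges: the summands
  agree one by one, so both sides take \<open>lim\<close> of the same sequence.\<close>

lemma cmod_u_app:
  "cmod (u_app \<theta> G \<epsilon> t x) = cmod (lim (\<lambda>N. \<Sum>n\<in>freq (Suc N). wave \<theta> \<epsilon> t x n (G n)))"
proof -
  have "of_real (coeff_c \<theta> n) * G n * exp (\<i> * of_int n * of_real x) *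
       exp (\<i> * of_real (t * \<epsilon>\<^sup>2 * (coeff_c \<theta> n)\<^sup>2 * (cmod (G n))\<^sup>2)
            - \<i> * of_real (t * (real_of_int n)\<^sup>2)) = wave \<theta> \<epsilon> t x n (G n)" for n
    by (simp add: wave_def phase_def mult.assoc exp_add[symmetric]) (simp add: algebra_simps)
  then show ?thesis
    by (simp add: u_app_def series_int_def freq_Suc norm_mult)
qed

text \<open>To be read with L = 2^k and E = eps^(-1/2). The phase moves in t at speed at most L^2
  from the nonlinear part, because \<epsilon> |w| <= L, plus 4 L^2 from n^2, and in x at speed at
  most 2 L <= 2 L^2. This makes 7 L^2, and the amplitude contributes L E.\<close>

lemma wave_diff_le:
  fixes L E h :: real
  assumes "\<theta> > 0" and n: "\<bar>real_of_int n\<bar> \<le> 2 * L" and w: "cmod w \<le> L * E" and L: "L \<ge> 1"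
    and E: "E \<ge> 0" "\<epsilon> * E \<le> 1" and \<epsilon>: "\<epsilon> \<ge> 0"
    and h: "\<bar>t - t'\<bar> \<le> h" "\<bar>x - x'\<bar> \<le> h"
  shows "cmod (wave \<theta> \<epsilon> t x n w - wave \<theta> \<epsilon> t' x' n w) \<le> 7 * L ^ 3 * E * h"
proof -
  have h0: "h \<ge> 0"
    using h by linarith
  have "\<epsilon> * cmod w \<le> L"
  proof -
    have "\<epsilon> * cmod w \<le> \<epsilon> * (L * E)"
      using w \<epsilon> by (rule mult_left_mono)
    also have "\<dots> = L * (\<epsilon> * E)"
      by simp
    also have "\<dots> \<le> L * 1"
      using E L by (intro mult_left_mono) auto
    finally show ?thesis by simp
  qed
  then have ew: "(\<epsilon> * cmod w)\<^sup>2 \<le> L\<^sup>2"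
    using \<epsilon> by (intro power_mono) auto
  have c: "(coeff_c \<theta> n)\<^sup>2 \<le> 1"
    using coeff_c_le_1[OF assms(1), of n] coeff_c_pos[of \<theta> n] by (simp add: power_le_one)
  have "(coeff_c \<theta> n)\<^sup>2 * (\<epsilon> * cmod w)\<^sup>2 \<le> 1 * L\<^sup>2"
    using ew c by (intro mult_mono) auto
  then have a: "\<bar>\<epsilon>\<^sup>2 * (coeff_c \<theta> n)\<^sup>2 * (cmod w)\<^sup>2\<bar> \<le> L\<^sup>2"
    by (simp add: power_mult_distrib abs_mult mult_ac)
  have "\<bar>real_of_int n\<bar>\<^sup>2 \<le> (2 * L)\<^sup>2"
    using n by (intro power_mono) auto
  then have b: "(real_of_int n)\<^sup>2 \<le> 4 * L\<^sup>2"
    by (simp add: power_mult_distrib)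
  let ?v = "\<epsilon>\<^sup>2 * (coeff_c \<theta> n)\<^sup>2 * (cmod w)\<^sup>2 - (real_of_int n)\<^sup>2"
  have v: "\<bar>?v\<bar> \<le> 5 * L\<^sup>2"
    using a b zero_le_power2[of "real_of_int n"] zero_le_power2[of L] by linarith
  have "phase \<theta> \<epsilon> t x n w - phase \<theta> \<epsilon> t' x' n w = real_of_int n * (x - x') + (t - t') * ?v"
    by (simp add: phase_def algebra_simps)
  then have "\<bar>phase \<theta> \<epsilon> t x n w - phase \<theta> \<epsilon> t' x' n w\<bar> \<le> \<bar>real_of_int n\<bar> * \<bar>x - x'\<bar> + \<bar>t - t'\<bar> * \<bar>?v\<bar>"
    by (metis abs_mult abs_triangle_ineq)
  also have "\<dots> \<le> (2 * L) * h + h * (5 * L\<^sup>2)"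
    using n h v h0 L by (intro add_mono mult_mono) auto
  also have "\<dots> \<le> 7 * L\<^sup>2 * h"
    using mult_right_mono[of L "L\<^sup>2" h] L h0 by (simp add: power2_eq_square algebra_simps)
  finally have p: "\<bar>phase \<theta> \<epsilon> t x n w - phase \<theta> \<epsilon> t' x' n w\<bar> \<le> 7 * L\<^sup>2 * h" .
  have "cmod (wave \<theta> \<epsilon> t x n w - wave \<theta> \<epsilon> t' x' n w)
      = coeff_c \<theta> n * cmod w * cmod (exp (\<i> * of_real (phase \<theta> \<epsilon> t x n w)) - exp (\<i> * of_real (phase \<theta> \<epsilon> t' x' n w)))"
    using coeff_c_pos[of \<theta> n] unfolding wave_def right_diff_distrib[symmetric] norm_mult by simp
  also have "\<dots> \<le> 1 * (L * E) * (7 * L\<^sup>2 * h)"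
    using coeff_c_le_1[OF assms(1), of n] coeff_c_pos[of \<theta> n] w L E h0
    by (intro mult_mono order_trans[OF cmod_exp_i_diff_le p]) auto
  finally show ?thesis
    by (simp add: power2_eq_square power3_eq_cube mult_ac)
qed

text \<open>At most 4 * 2^k frequencies, each with the bound 7 (2^k)^3 E h, account for 28 and
  16^k.\<close>

lemma wave_sum_diff_le:
  fixes E h :: real
  assumes "\<theta> > 0" and A: "A \<subseteq> freq (2 ^ Suc k)" and G: "\<And>n. n \<in> A \<Longrightarrow> cmod (G n) \<le> 2 ^ k * E"
    and E: "E \<ge> 0" "\<epsilon> * E \<le> 1" and \<epsilon>: "\<epsilon> \<ge> 0"
    and h: "\<bar>t - t'\<bar> \<le> h" "\<bar>x - x'\<bar> \<le> h"
  shows "cmod ((\<Sum>n\<in>A. wave \<theta> \<epsilon> t x n (G n)) - (\<Sum>n\<in>A. wave \<theta> \<epsilon> t' x' n (G n))) \<le> 28 * 16 ^ k * E * h"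
proof -
  have h0: "h \<ge> 0"
    using h by linarith
  have "card A \<le> card (freq (2 ^ Suc k))"
    using A by (intro card_mono) auto
  then have card: "card A \<le> 4 * 2 ^ k"
    using card_freq_le[of "2 ^ Suc k"] by simp
  have "cmod ((\<Sum>n\<in>A. wave \<theta> \<epsilon> t x n (G n)) - (\<Sum>n\<in>A. wave \<theta> \<epsilon> t' x' n (G n)))
      = cmod (\<Sum>n\<in>A. wave \<theta> \<epsilon> t x n (G n) - wave \<theta> \<epsilon> t' x' n (G n))"
    by (simp add: sum_subtractf)
  also have "\<dots> \<le> real (card A) * (7 * (2 ^ k) ^ 3 * E * h)"
  proof (intro sum_norm_bound wave_diff_le assms)
    fix n assume "n \<in> A"
    then have "\<bar>n\<bar> < 2 * 2 ^ k"
      using A by (auto simp: freq_def)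
    then have "real_of_int \<bar>n\<bar> < real_of_int (2 * 2 ^ k)"
      by (simp only: of_int_less_iff)
    then show "\<bar>real_of_int n\<bar> \<le> 2 * 2 ^ k"
      by simp
  qed (use G in auto)
  also have "\<dots> \<le> real (4 * 2 ^ k) * (7 * (2 ^ k) ^ 3 * E * h)"
    using card E h0 by (intro mult_right_mono) (simp_all only: of_nat_le_iff, auto)
  also have "\<dots> = 28 * ((2 ^ k) ^ 4) * E * h"
    by (simp add: eval_nat_numeral mult_ac)
  also have "(2 ^ k :: real) ^ 4 = (2 ^ 4) ^ k"
    by (simp only: power_mult[symmetric] mult.commute)
  finally show ?thesis by simp
qed

text \<open>Telescoping over powers of two would give convergence only along m = 2^k. The hypothesis
  on all m inside a block closes the gaps, so the whole sequence is Cauchy.\<close>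

lemma dyadic_convergent:
  fixes s :: "nat \<Rightarrow> 'a::banach" and d :: "nat \<Rightarrow> real"
  assumes d: "\<And>k. d k \<ge> 0" "summable d"
    and s: "\<And>k m. \<lbrakk>k0 \<le> k; 2 ^ k \<le> m; m \<le> 2 ^ Suc k\<rbrakk> \<Longrightarrow> norm (s m - s (2 ^ k)) \<le> d k"
  shows "convergent s" and "norm (lim s - s (2 ^ k0)) \<le> (\<Sum>i. d (i + k0))"
proof -
  have step: "norm (s (2 ^ (j + i)) - s (2 ^ j)) \<le> (\<Sum>l<i. d (l + j))" if "k0 \<le> j" for i j
  proof (induction i)
    case (Suc i)
    have "norm (s (2 ^ (j + Suc i)) - s (2 ^ (j + i))) \<le> d (i + j)"
      using s[of "j + i" "2 ^ (j + Suc i)"] that by (simp add: add.commute)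
    with Suc show ?case
      using norm_triangle_ineq[of "s (2 ^ (j + Suc i)) - s (2 ^ (j + i))" "s (2 ^ (j + i)) - s (2 ^ j)"]
      by simp
  qed simp
  have bound: "norm (s m - s (2 ^ j)) \<le> (\<Sum>i. d (i + j))" if j: "k0 \<le> j" and m: "2 ^ j \<le> m" for j m
  proof -
    have m0: "m > 0"
      using m by (metis gr0I le_zero_eq power_not_zero zero_neq_numeral)
    obtain k where k: "2 ^ k \<le> m" "m < 2 ^ Suc k"
      using ex_power_ivl1[of 2 m] m0 by auto
    have "(2::nat) ^ j < 2 ^ Suc k"
      using m k by linarith
    then have "j \<le> k"
      by (simp add: power_strict_increasing_iff del: power_Suc)
    then obtain i where i: "k = j + i"
      using le_Suc_ex by blast
    have "norm (s m - s (2 ^ j)) \<le> norm (s m - s (2 ^ k)) + norm (s (2 ^ k) - s (2 ^ j))"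
      using norm_triangle_ineq[of "s m - s (2 ^ k)" "s (2 ^ k) - s (2 ^ j)"] by simp
    \<comment> \<open>The incomplete last block costs one further term d k, which extends the
      telescoped sum by one index.\<close>
    also have "\<dots> \<le> d (i + j) + (\<Sum>l<i. d (l + j))"
      using s[of k m] step[OF j, of i] j k by (intro add_mono) (auto simp: i add.commute)
    also have "\<dots> = (\<Sum>l<Suc i. d (l + j))"
      by simp
    also have "\<dots> \<le> (\<Sum>l. d (l + j))"
      using d by (intro sum_le_suminf summable_ignore_initial_segment) auto
    finally show ?thesis .
  qed
  have "Cauchy s"
  proof (rule CauchyI)
    fix e :: real assume "e > 0"
    then have "\<forall>\<^sub>F j in sequentially. (\<Sum>i. d (i + j)) < e / 2"
      by (intro order_tendstoD(2)[OF suminf_exist_split2[OF d(2)]]) simp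
    from eventually_happens[OF eventually_conj[OF this eventually_ge_at_top[of k0]]]
    obtain j where j: "j \<ge> k0" "(\<Sum>i. d (i + j)) < e / 2"
      by auto
    have "norm (s m - s m') < e" if "2 ^ j \<le> m" "2 ^ j \<le> m'" for m m'
      using bound[OF j(1) that(1)] bound[OF j(1) that(2)] j(2)
        norm_triangle_ineq4[of "s m - s (2 ^ j)" "s m' - s (2 ^ j)"] by simp
    then show "\<exists>M. \<forall>m\<ge>M. \<forall>n\<ge>M. norm (s m - s n) < e"
      by blast
  qed
  then show conv: "convergent s"
    by (simp add: Cauchy_convergent_iff)
  have "(\<lambda>m. norm (s m - s (2 ^ k0))) \<longlonglongrightarrow> norm (lim s - s (2 ^ k0))"
    using conv by (intro tendsto_intros) (simp add: convergent_LIMSEQ_iff)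
  then show "norm (lim s - s (2 ^ k0)) \<le> (\<Sum>i. d (i + k0))"
    by (rule Lim_bounded[where M = "2 ^ k0"]) (auto intro: bound)
qed

section \<open>Uniform control of the tail\<close>

lemma filterlim_realpow_at_top:
  fixes d :: real
  assumes "d > 1"
  shows "filterlim (\<lambda>k. d ^ k) at_top sequentially"
  using assms by (intro filterlim_at_infinity_imp_filterlim_at_top filterlim_realpow_sequentially_gt1) auto

text \<open>Net sizes and Lipschitz constants grow like q^k, while block probabilities decay like
  the exponential of a geometric sequence. The ratio of consecutive terms, q exp(-c (d - 1) d^k),
  tends to 0, so no growth rate q can spoil summability.\<close>

lemma summable_power_times_exp:
  fixes q c d :: real
  assumes "q > 0" "c > 0" "d > 1"
  shows "summable (\<lambda>k. q ^ k * exp (- (c * d ^ k)))"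
proof -
  have "filterlim (\<lambda>k. c * (d - 1) * d ^ k) at_top sequentially"
    using assms by (intro filterlim_tendsto_pos_mult_at_top[OF tendsto_const] filterlim_realpow_at_top) auto
  then have "\<forall>\<^sub>F k in sequentially. c * (d - 1) * d ^ k \<ge> ln (2 * q)"
    by (rule filterlim_at_top[THEN iffD1, rule_format])
  then obtain N where N: "\<And>k. k \<ge> N \<Longrightarrow> c * (d - 1) * d ^ k \<ge> ln (2 * q)"
    by (auto simp: eventually_sequentially)
  show ?thesis
  proof (rule summable_ratio_test[of "1 / 2" N])
    fix k assume "k \<ge> N"
    have "q * exp (- (c * (d - 1) * d ^ k)) \<le> q * exp (- ln (2 * q))"
      using N[OF \<open>k \<ge> N\<close>] assms by (intro mult_left_mono) auto
    also have "\<dots> = 1 / 2"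
      using assms by (simp add: exp_minus field_simps)
    finally have "q ^ k * exp (- (c * d ^ k)) * (q * exp (- (c * (d - 1) * d ^ k))) \<le> q ^ k * exp (- (c * d ^ k)) * (1 / 2)"
      using assms by (intro mult_left_mono) auto
    moreover have "q ^ Suc k * exp (- (c * d ^ Suc k)) = q ^ k * exp (- (c * d ^ k)) * (q * exp (- (c * (d - 1) * d ^ k)))"
      by (simp add: exp_add[symmetric] algebra_simps)
    ultimately show "norm (q ^ Suc k * exp (- (c * d ^ Suc k))) \<le> 1 / 2 * norm (q ^ k * exp (- (c * d ^ k)))"
      using assms by (simp add: abs_mult)
  qed simp
qed

lemma nat_floor_grid:
  fixes t h :: real
  assumes "h > 0" "0 \<le> t" "t \<le> b"
  shows "nat \<lfloor>t / h\<rfloor> \<le> nat \<lfloor>b / h\<rfloor>" "\<bar>t - real (nat \<lfloor>t / h\<rfloor>) * h\<bar> \<le> h"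
proof -
  show "nat \<lfloor>t / h\<rfloor> \<le> nat \<lfloor>b / h\<rfloor>"
    using assms by (intro nat_mono floor_mono divide_right_mono) auto
  have n: "real (nat \<lfloor>t / h\<rfloor>) = of_int \<lfloor>t / h\<rfloor>"
    using assms by simp
  have "of_int \<lfloor>t / h\<rfloor> * h \<le> t" "t \<le> (of_int \<lfloor>t / h\<rfloor> + 1) * h"
    using assms by (simp_all add: pos_le_divide_eq[symmetric] pos_divide_le_eq[symmetric])
  then show "\<bar>t - real (nat \<lfloor>t / h\<rfloor>) * h\<bar> \<le> h"
    unfolding n by (simp add: algebra_simps)
qed

context gaussian_family
begin

text \<open>Chosen so that the oscillation bound of \<open>wave_sum_diff_le\<close> over one cell of the net equals the
  threshold \<open>\<delta> * rho \<theta> ^ k / sqrt \<epsilon>\<close> of the block.\<close>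

definition mesh :: "real \<Rightarrow> real \<Rightarrow> nat \<Rightarrow> real" where
  "mesh \<theta> \<delta> k = \<delta> * rho \<theta> ^ k / (28 * 16 ^ k)"

definition net_bad :: "real \<Rightarrow> real \<Rightarrow> real \<Rightarrow> nat \<Rightarrow> nat \<Rightarrow> nat \<Rightarrow> nat \<Rightarrow> 'a set" where
  "net_bad \<theta> \<delta> \<epsilon> k m j l = {\<omega> \<in> space M. \<delta> * rho \<theta> ^ k / sqrt \<epsilon> \<le>
     cmod (\<Sum>n\<in>freq m - freq (2 ^ k). wave \<theta> \<epsilon> (real j * mesh \<theta> \<delta> k) (real l * mesh \<theta> \<delta> k) n (g n \<omega>))}"

text \<open>The first union bounds the random phase speeds, so that off this event the mesh can be
  deterministic. The second runs over every upper end m in the block, because convergence of the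
  series involves all symmetric partial sums. Both unions are finite.\<close>

definition block_bad :: "real \<Rightarrow> real \<Rightarrow> real \<Rightarrow> real \<Rightarrow> nat \<Rightarrow> 'a set" where
  "block_bad \<theta> \<delta> K \<epsilon> k =
     (\<Union>n\<in>freq (2 ^ Suc k). {\<omega> \<in> space M. 2 ^ k / sqrt \<epsilon> \<le> cmod (g n \<omega>)}) \<union>
     (\<Union>(m, j, l)\<in>{2 ^ k..2 ^ Suc k} \<times> {..nat \<lfloor>K / \<epsilon> / mesh \<theta> \<delta> k\<rfloor>} \<times> {..nat \<lfloor>2 * pi / mesh \<theta> \<delta> k\<rfloor>}.
        net_bad \<theta> \<delta> \<epsilon> k m j l)"

lemma wave_g_measurable [measurable]: "(\<lambda>\<omega>. wave \<theta> \<epsilon> t x n (g n \<omega>)) \<in> borel_measurable M"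
  using measurable_compose[OF g_measurable wave_measurable] .

lemma net_bad_events [measurable]: "net_bad \<theta> \<delta> \<epsilon> k m j l \<in> events"
  unfolding net_bad_def by measurable

lemma block_bad_events [measurable]: "block_bad \<theta> \<delta> K \<epsilon> k \<in> events"
  unfolding block_bad_def by (intro sets.Un sets.finite_UN) auto

text \<open>The squared threshold \<delta>^2 rho^(2k) / \<epsilon> is compared with the variance
  proxy 4 rho^(4k), which leaves a factor rho^(-2k) growing geometrically in k; 64 is 16 *
  4.\<close>

lemma prob_net_bad:
  assumes "\<theta> > 0" "\<delta> > 0" "\<epsilon> > 0" "m \<le> 2 ^ Suc k"
  shows "prob (net_bad \<theta> \<delta> \<epsilon> k m j l) \<le> 4 * exp (- (\<delta>\<^sup>2 / 64 * (1 / (rho \<theta>)\<^sup>2) ^ k / \<epsilon>))"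
proof -
  note rho = rho_bounds[OF assms(1)]
  have "prob (net_bad \<theta> \<delta> \<epsilon> k m j l) \<le> 4 * exp (- ((\<delta> * rho \<theta> ^ k / sqrt \<epsilon>)\<^sup>2 / (16 * (4 * rho \<theta> ^ (4 * k)))))"
    unfolding net_bad_def
    using assms rho freq_mono[OF assms(4)] coeff_c_pos[of \<theta>]
    by (intro complex_odd_sum_tail[where c = "coeff_c \<theta>"] sum_coeff_c_square_block)
      (auto simp: wave_measurable wave_minus cmod_wave less_imp_le)
  also have "(\<delta> * rho \<theta> ^ k / sqrt \<epsilon>)\<^sup>2 / (16 * (4 * rho \<theta> ^ (4 * k))) = \<delta>\<^sup>2 / 64 * (1 / (rho \<theta>)\<^sup>2) ^ k / \<epsilon>"
  proof -
    have "rho \<theta> ^ (4 * k) = (rho \<theta> ^ k)\<^sup>2 * ((rho \<theta>)\<^sup>2) ^ k"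
      by (simp add: power_mult[symmetric] power_add[symmetric] mult.commute)
    then show ?thesis
      using assms rho by (simp add: power_divide power_mult_distrib power_one_over field_simps)
  qed
  finally show ?thesis .
qed

text \<open>The factor 1 / \<epsilon> comes from the number of time steps in an interval of length K
  / \<epsilon>. The union over single Gaussians does not have it and receives it for free from
  \<epsilon> <= 1, which gives both parts the same form.\<close>

lemma prob_block_bad:
  assumes "\<theta> > 0" "\<delta> > 0" "K > 0" "\<epsilon> > 0" "\<epsilon> \<le> 1"
  shows "prob (block_bad \<theta> \<delta> K \<epsilon> k) \<le>
    (8 * 2 ^ k * exp (- (4 ^ k / 2 / \<epsilon>)) +
     8 * 2 ^ k * (K / mesh \<theta> \<delta> k + 1) * (2 * pi / mesh \<theta> \<delta> k + 1) *
       exp (- (\<delta>\<^sup>2 / 64 * (1 / (rho \<theta>)\<^sup>2) ^ k / \<epsilon>))) / \<epsilon>"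
proof -
  define h where "h = mesh \<theta> \<delta> k"
  have h: "h > 0"
    using assms rho_bounds[OF assms(1)] by (simp add: h_def mesh_def)
  define e1 where "e1 = exp (- (4 ^ k / 2 / \<epsilon>))"
  define e2 where "e2 = exp (- (\<delta>\<^sup>2 / 64 * (1 / (rho \<theta>)\<^sup>2) ^ k / \<epsilon>))"
  let ?A = "\<lambda>n. {\<omega> \<in> space M. 2 ^ k / sqrt \<epsilon> \<le> cmod (g n \<omega>)}"
  let ?I = "{2 ^ k..2 ^ Suc k} \<times> {..nat \<lfloor>K / \<epsilon> / h\<rfloor>} \<times> {..nat \<lfloor>2 * pi / h\<rfloor>} :: (nat \<times> nat \<times> nat) set"
  have "prob (\<Union>n\<in>freq (2 ^ Suc k). ?A n) \<le> (\<Sum>n\<in>freq (2 ^ Suc k). prob (?A n))"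
    by (intro measure_subadditive_finite) (auto simp: emeasure_eq_measure)
  also have "\<dots> \<le> real (card (freq (2 ^ Suc k))) * (2 * e1)"
  proof (intro sum_bounded_above)
    fix n
    have "(2 ^ k / sqrt \<epsilon>)\<^sup>2 / 2 = 4 ^ k / 2 / \<epsilon>"
      using assms by (simp add: power_divide power2_eq_square power_mult_distrib[symmetric])
    then show "prob (?A n) \<le> 2 * e1"
      using gaussian_tail[of "2 ^ k / sqrt \<epsilon>" n] assms by (simp add: e1_def mult.commute)
  qed
  also have "\<dots> \<le> real (2 * 2 ^ Suc k) * (2 * e1)"
    using card_freq_le[of "2 ^ Suc k"] by (intro mult_right_mono) (simp_all only: of_nat_le_iff, simp add: e1_def)
  also have "\<dots> \<le> 8 * 2 ^ k * e1 / \<epsilon>"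
    using assms by (simp add: e1_def field_simps mult_left_le)
  finally have 1: "prob (\<Union>n\<in>freq (2 ^ Suc k). ?A n) \<le> 8 * 2 ^ k * e1 / \<epsilon>" .
  have "prob (\<Union>(m, j, l)\<in>?I. net_bad \<theta> \<delta> \<epsilon> k m j l) \<le> (\<Sum>(m, j, l)\<in>?I. prob (net_bad \<theta> \<delta> \<epsilon> k m j l))"
    unfolding split_beta by (intro measure_subadditive_finite) (auto simp: emeasure_eq_measure)
  also have "\<dots> \<le> real (card ?I) * (4 * e2)"
    unfolding e2_def using prob_net_bad[OF assms(1,2,4)] by (intro sum_bounded_above) (clarify, simp)
  also have "real (card ?I) = (2 ^ k + 1) * (real (nat \<lfloor>K / \<epsilon> / h\<rfloor>) + 1) * (real (nat \<lfloor>2 * pi / h\<rfloor>) + 1)"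
    by (simp add: card_cartesian_product algebra_simps)
  also have "\<dots> * (4 * e2) \<le> (2 * 2 ^ k) * ((K / h + 1) / \<epsilon>) * (2 * pi / h + 1) * (4 * e2)"
  proof (intro mult_right_mono mult_mono)
    have "real (nat \<lfloor>K / \<epsilon> / h\<rfloor>) \<le> K / \<epsilon> / h"
      using assms h by (simp add: of_nat_nat)
    also have "\<dots> + 1 \<le> (K / h + 1) / \<epsilon>"
      using assms h by (simp add: field_simps)
    finally show "real (nat \<lfloor>K / \<epsilon> / h\<rfloor>) + 1 \<le> (K / h + 1) / \<epsilon>"
      by simp
    show "real (nat \<lfloor>2 * pi / h\<rfloor>) + 1 \<le> 2 * pi / h + 1"
      using h by (simp add: of_nat_nat)
  qed (use assms h in \<open>auto simp: e2_def\<close>)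
  also have "\<dots> = 8 * 2 ^ k * (K / h + 1) * (2 * pi / h + 1) * e2 / \<epsilon>"
    by simp
  finally have 2: "prob (\<Union>(m, j, l)\<in>?I. net_bad \<theta> \<delta> \<epsilon> k m j l)
      \<le> 8 * 2 ^ k * (K / h + 1) * (2 * pi / h + 1) * e2 / \<epsilon>" .
  have "prob (block_bad \<theta> \<delta> K \<epsilon> k)
      \<le> prob (\<Union>n\<in>freq (2 ^ Suc k). ?A n) + prob (\<Union>(m, j, l)\<in>?I. net_bad \<theta> \<delta> \<epsilon> k m j l)"
    unfolding block_bad_def h_def[symmetric] by (intro measure_Un_le sets.finite_UN) auto
  with 1 2 show ?thesis
    unfolding e1_def e2_def h_def by (simp add: add_divide_distrib)
qed

text \<open>The value at the nearest lower net point and the oscillation over one cell are each at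
  most \<delta> rho^k / sqrt \<epsilon>, hence the 2.\<close>

lemma block_good:
  assumes "\<theta> > 0" "\<delta> > 0" "\<epsilon> > 0" "\<epsilon> \<le> 1" and \<omega>: "\<omega> \<in> space M" "\<omega> \<notin> block_bad \<theta> \<delta> K \<epsilon> k"
    and t: "0 \<le> t" "t \<le> K / \<epsilon>" and x: "0 \<le> x" "x \<le> 2 * pi" and m: "2 ^ k \<le> m" "m \<le> 2 ^ Suc k"
  shows "cmod ((\<Sum>n\<in>freq m. wave \<theta> \<epsilon> t x n (g n \<omega>)) - (\<Sum>n\<in>freq (2 ^ k). wave \<theta> \<epsilon> t x n (g n \<omega>)))
    \<le> 2 * \<delta> / sqrt \<epsilon> * rho \<theta> ^ k"
proof -
  define h where "h = mesh \<theta> \<delta> k"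
  have h: "h > 0"
    using assms rho_bounds[OF assms(1)] by (simp add: h_def mesh_def)
  define j where "j = nat \<lfloor>t / h\<rfloor>"
  define l where "l = nat \<lfloor>x / h\<rfloor>"
  define A where "A = freq m - freq (2 ^ k)"
  let ?S = "\<lambda>t x. \<Sum>n\<in>A. wave \<theta> \<epsilon> t x n (g n \<omega>)"
  have A: "A \<subseteq> freq (2 ^ Suc k)"
    using freq_mono[OF m(2)] by (auto simp: A_def)
  have "\<omega> \<notin> net_bad \<theta> \<delta> \<epsilon> k m j l"
    using \<omega> m nat_floor_grid(1)[OF h t] nat_floor_grid(1)[OF h x]
    by (fastforce simp: block_bad_def h_def j_def l_def)
  then have net: "cmod (?S (real j * h) (real l * h)) \<le> \<delta> * rho \<theta> ^ k / sqrt \<epsilon>"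
    using \<omega>(1) by (simp add: net_bad_def A_def h_def)
  have "cmod (?S t x - ?S (real j * h) (real l * h)) \<le> 28 * 16 ^ k * (1 / sqrt \<epsilon>) * h"
  proof (rule wave_sum_diff_le[OF assms(1) A])
    fix n assume "n \<in> A"
    then have "n \<in> freq (2 ^ Suc k)"
      using A by blast
    then show "cmod (g n \<omega>) \<le> 2 ^ k * (1 / sqrt \<epsilon>)"
      using \<omega> by (fastforce simp: block_bad_def)
  next
    show "\<epsilon> * (1 / sqrt \<epsilon>) \<le> 1"
      using assms by (simp add: real_div_sqrt)
    show "\<bar>t - real j * h\<bar> \<le> h" "\<bar>x - real l * h\<bar> \<le> h"
      unfolding j_def l_def using nat_floor_grid(2)[OF h t] nat_floor_grid(2)[OF h x] by auto
  qed (use assms in auto)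
  also have "28 * 16 ^ k * (1 / sqrt \<epsilon>) * h = \<delta> * rho \<theta> ^ k / sqrt \<epsilon>"
    by (simp add: h_def mesh_def)
  finally have "cmod (?S t x) \<le> 2 * \<delta> / sqrt \<epsilon> * rho \<theta> ^ k"
    using net norm_triangle_ineq[of "?S t x - ?S (real j * h) (real l * h)" "?S (real j * h) (real l * h)"] by simp
  moreover have "(\<Sum>n\<in>freq m. wave \<theta> \<epsilon> t x n (g n \<omega>)) - (\<Sum>n\<in>freq (2 ^ k). wave \<theta> \<epsilon> t x n (g n \<omega>)) = ?S t x"
    using sum.subset_diff[OF freq_mono[OF m(1)] finite_freq, of "\<lambda>n. wave \<theta> \<epsilon> t x n (g n \<omega>)"] by (simp add: A_def)
  ultimately show ?thesis
    by simp
qed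

text \<open>The order of choices matters: \<open>C\<close> is fixed before the cutoff
  \<open>k0\<close>, and one cutoff serves all \<epsilon> in (0, 1]. Any large \<open>k0\<close>
  works, so later arguments can impose further conditions on it. A larger exponent \<open>A\<close>
  is paid for by a larger cutoff and a larger \<open>C\<close>.\<close>

lemma tail_control:
  assumes "\<theta> > 0" "\<delta> > 0" "K > 0"
  obtains C where "\<forall>\<^sub>F k0 in sequentially. \<forall>\<epsilon>. 0 < \<epsilon> \<longrightarrow> \<epsilon> \<le> 1 \<longrightarrow> (\<exists>B\<in>events. prob B \<le> C / \<epsilon> * exp (- (A / \<epsilon>)) \<and>
    (\<forall>\<omega>\<in>space M - B. \<forall>t x. 0 \<le> t \<longrightarrow> t \<le> K / \<epsilon> \<longrightarrow> 0 \<le> x \<longrightarrow> x \<le> 2 * pi \<longrightarrow>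
       cmod (lim (\<lambda>N. \<Sum>n\<in>freq (Suc N). wave \<theta> \<epsilon> t x n (g n \<omega>)) - (\<Sum>n\<in>freq (2 ^ k0). wave \<theta> \<epsilon> t x n (g n \<omega>))) \<le> \<delta> / sqrt \<epsilon>))"
proof -
  note rho = rho_bounds[OF assms(1)]
  define r where "r = rho \<theta>"
  have r: "0 < r" "r < 1"
    using rho by (auto simp: r_def)
  \<comment> \<open>Makes the sum of the block bounds 2 d r^k / sqrt \<epsilon> over all k equal to
    \<delta> / sqrt \<epsilon>.\<close>
  define d where "d = \<delta> * (1 - r) / 2"
  have d: "d > 0"
    using assms r by (simp add: d_def)
  define W1 where "W1 k = (8 * 2 ^ k :: real)" for k :: nat
  define W2 where "W2 k = 8 * 2 ^ k * (K / mesh \<theta> d k + 1) * (2 * pi / mesh \<theta> d k + 1)" for k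
  define a where "a k = (4 ^ k / 2 :: real)" for k :: nat
  define b where "b k = d\<^sup>2 / 64 * (1 / r\<^sup>2) ^ k" for k :: nat
  have r2: "1 / r\<^sup>2 > 1"
    using r by (simp add: power_less_one_iff)
  have mesh: "mesh \<theta> d k > 0" for k
    using d rho by (simp add: mesh_def)
  have sum1: "summable (\<lambda>k. W1 k * exp (- a k))"
    using summable_mult[OF summable_power_times_exp[of 2 "1 / 2" 4], of 8] by (simp add: W1_def a_def mult.assoc)
  have sum2: "summable (\<lambda>k. W2 k * exp (- b k))"
  proof (rule summable_comparison_test')
    \<comment> \<open>The growth factor of 1 / mesh. Both grid sizes grow like q^k and the number of
      upper ends like 2^k, so \<open>W2\<close> is O((2 q^2)^k).\<close>
    define q where "q = 16 / r"
    have q: "q \<ge> 1"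
      using r by (simp add: q_def field_simps)
    define c1 where "c1 = K * 28 / d + 1"
    define c2 where "c2 = 2 * pi * 28 / d + 1"
    show "summable (\<lambda>k. 8 * c1 * c2 * ((2 * q\<^sup>2) ^ k * exp (- (d\<^sup>2 / 64 * (1 / r\<^sup>2) ^ k))))"
      using d q r2 by (intro summable_mult summable_power_times_exp) auto
    fix k :: nat
    have grid: "v / mesh \<theta> d k + 1 \<le> (v * 28 / d + 1) * q ^ k" if "v \<ge> 0" for v
    proof -
      have "v / mesh \<theta> d k = v * 28 / d * q ^ k"
        using r d by (simp add: mesh_def q_def r_def[symmetric] power_divide field_simps)
      then show ?thesis
        using one_le_power[OF q, of k] by (simp add: distrib_right)
    qed
    have "W2 k \<le> 8 * 2 ^ k * (c1 * q ^ k) * (c2 * q ^ k)"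
      unfolding W2_def c1_def c2_def using mesh[of k] assms q d
      by (intro mult_mono grid) (auto intro!: add_nonneg_nonneg mult_nonneg_nonneg)
    also have "\<dots> = 8 * c1 * c2 * (2 * q\<^sup>2) ^ k"
      by (simp add: power_mult_distrib power2_eq_square)
    finally have W2: "W2 k * exp (- b k) \<le> 8 * c1 * c2 * (2 * q\<^sup>2) ^ k * exp (- b k)"
      by (intro mult_right_mono) auto
    have "W2 k \<ge> 0"
      using mesh[of k] assms by (simp add: W2_def)
    with W2 show "norm (W2 k * exp (- b k)) \<le> 8 * c1 * c2 * ((2 * q\<^sup>2) ^ k * exp (- (d\<^sup>2 / 64 * (1 / r\<^sup>2) ^ k)))"
      by (simp add: b_def mult.assoc abs_mult)
  qed
  define V where "V k = W1 k * exp (- a k) + W2 k * exp (- b k)" for k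
  have V: "summable V" "\<And>k. V k \<ge> 0"
    unfolding V_def using summable_add[OF sum1 sum2] mesh assms by (auto simp: W1_def W2_def less_imp_le)
  define C where "C = exp A * (\<Sum>k. V k)"
  have "filterlim (\<lambda>k. a k) at_top sequentially"
    using filterlim_tendsto_pos_mult_at_top[OF tendsto_const[of "1/2"] _ filterlim_realpow_at_top[of 4]]
    by (simp add: a_def)
  then have ev1: "\<forall>\<^sub>F k0 in sequentially. \<forall>k\<ge>k0. A \<le> a k"
    by (auto simp: filterlim_at_top intro: eventually_all_ge_at_top)
  have "filterlim (\<lambda>k. b k) at_top sequentially"
    unfolding b_def using d r2
    by (intro filterlim_tendsto_pos_mult_at_top[OF tendsto_const] filterlim_realpow_at_top) auto
  then have ev2: "\<forall>\<^sub>F k0 in sequentially. \<forall>k\<ge>k0. A \<le> b k"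
    by (auto simp: filterlim_at_top intro: eventually_all_ge_at_top)
  have "\<forall>\<^sub>F k0 in sequentially. \<forall>\<epsilon>. 0 < \<epsilon> \<longrightarrow> \<epsilon> \<le> 1 \<longrightarrow> (\<exists>B\<in>events. prob B \<le> C / \<epsilon> * exp (- (A / \<epsilon>)) \<and>
    (\<forall>\<omega>\<in>space M - B. \<forall>t x. 0 \<le> t \<longrightarrow> t \<le> K / \<epsilon> \<longrightarrow> 0 \<le> x \<longrightarrow> x \<le> 2 * pi \<longrightarrow>
       cmod (lim (\<lambda>N. \<Sum>n\<in>freq (Suc N). wave \<theta> \<epsilon> t x n (g n \<omega>)) - (\<Sum>n\<in>freq (2 ^ k0). wave \<theta> \<epsilon> t x n (g n \<omega>))) \<le> \<delta> / sqrt \<epsilon>))"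
    using ev1 ev2
  proof eventually_elim
    case (elim k0)
    show ?case
    proof (intro allI impI)
      fix \<epsilon> :: real assume \<epsilon>: "0 < \<epsilon>" "\<epsilon> \<le> 1"
      \<comment> \<open>As \<epsilon> <= 1, the surplus v - A over the target exponent is not
        reduced by dividing by \<epsilon>. So exp(-A / \<epsilon>) factors out of every block, and
        the weight exp(A - v) that remains is summable over the blocks and free of
        \<epsilon>.\<close>
      have ex: "exp (- (v / \<epsilon>)) \<le> exp A * exp (- (A / \<epsilon>)) * exp (- v)" if "A \<le> v" for v
      proof -
        have "(v - A) * 1 \<le> (v - A) * (1 / \<epsilon>)"
          using that \<epsilon> by (intro mult_left_mono) auto
        then have "- (v / \<epsilon>) \<le> A - A / \<epsilon> - v"
          by (simp add: diff_divide_distrib)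
        then show ?thesis
          by (simp add: exp_add[symmetric])
      qed
      define B where "B = (\<Union>i. block_bad \<theta> d K \<epsilon> (i + k0))"
      have le: "prob (block_bad \<theta> d K \<epsilon> (i + k0)) \<le> exp A * exp (- (A / \<epsilon>)) / \<epsilon> * V (i + k0)" for i
      proof -
        let ?k = "i + k0"
        have "prob (block_bad \<theta> d K \<epsilon> ?k) \<le> (W1 ?k * exp (- (a ?k / \<epsilon>)) + W2 ?k * exp (- (b ?k / \<epsilon>))) / \<epsilon>"
          using prob_block_bad[OF assms(1) d assms(3) \<epsilon>, of ?k] by (simp add: W1_def W2_def a_def b_def r_def)
        also have "\<dots> \<le> (W1 ?k * (exp A * exp (- (A / \<epsilon>)) * exp (- a ?k)) + W2 ?k * (exp A * exp (- (A / \<epsilon>)) * exp (- b ?k))) / \<epsilon>"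
          using elim \<epsilon> mesh assms
          by (intro divide_right_mono add_mono mult_left_mono ex) (auto simp: W1_def W2_def less_imp_le)
        also have "\<dots> = exp A * exp (- (A / \<epsilon>)) / \<epsilon> * V ?k"
          by (simp add: V_def algebra_simps add_divide_distrib)
        finally show ?thesis .
      qed
      have sumV: "summable (\<lambda>i. exp A * exp (- (A / \<epsilon>)) / \<epsilon> * V (i + k0))"
        using V by (intro summable_mult summable_ignore_initial_segment)
      have summ: "summable (\<lambda>i. prob (block_bad \<theta> d K \<epsilon> (i + k0)))"
        by (rule summable_comparison_test'[OF sumV]) (use le in simp)
      have "prob B \<le> (\<Sum>i. prob (block_bad \<theta> d K \<epsilon> (i + k0)))"
        unfolding B_def using summ by (intro finite_measure_subadditive_countably) auto
      also have "\<dots> \<le> (\<Sum>i. exp A * exp (- (A / \<epsilon>)) / \<epsilon> * V (i + k0))"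
        using le summ sumV by (intro suminf_le)
      also have "\<dots> = exp A * exp (- (A / \<epsilon>)) / \<epsilon> * (\<Sum>i. V (i + k0))"
        using V by (intro suminf_mult summable_ignore_initial_segment)
      also have "\<dots> \<le> exp A * exp (- (A / \<epsilon>)) / \<epsilon> * (\<Sum>i. V i)"
      proof (rule mult_left_mono)
        show "(\<Sum>i. V (i + k0)) \<le> (\<Sum>i. V i)"
          using suminf_split_initial_segment[OF V(1), of k0] V(2) by (simp add: sum_nonneg)
      qed (use \<epsilon> in simp)
      also have "\<dots> = C / \<epsilon> * exp (- (A / \<epsilon>))"
        by (simp add: C_def)
      finally have prob: "prob B \<le> C / \<epsilon> * exp (- (A / \<epsilon>))" .
      have B: "B \<in> events"
        unfolding B_def by (intro sets.countable_UN) auto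
      have good: "cmod (lim (\<lambda>N. \<Sum>n\<in>freq (Suc N). wave \<theta> \<epsilon> t x n (g n \<omega>)) - (\<Sum>n\<in>freq (2 ^ k0). wave \<theta> \<epsilon> t x n (g n \<omega>))) \<le> \<delta> / sqrt \<epsilon>"
        if \<omega>: "\<omega> \<in> space M - B" and tx: "0 \<le> t" "t \<le> K / \<epsilon>" "0 \<le> x" "x \<le> 2 * pi" for \<omega> t x
      proof -
        define s where "s m = (\<Sum>n\<in>freq m. wave \<theta> \<epsilon> t x n (g n \<omega>))" for m
        define D where "D k = 2 * d / sqrt \<epsilon> * r ^ k" for k
        have "summable D"
          using r unfolding D_def by (intro summable_mult summable_geometric) simp
        then have D: "summable D" "\<And>k. D k \<ge> 0"
          using r d \<epsilon> by (auto simp: D_def)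
        have s: "norm (s m - s (2 ^ k)) \<le> D k" if "k0 \<le> k" "2 ^ k \<le> m" "m \<le> 2 ^ Suc k" for k m
        proof -
          have "\<omega> \<notin> block_bad \<theta> d K \<epsilon> (k - k0 + k0)"
            using \<omega> unfolding B_def by blast
          then show ?thesis
            unfolding s_def D_def r_def using that \<omega> tx by (intro block_good[OF assms(1) d \<epsilon>]) auto
        qed
        have conv: "convergent s" and lim: "norm (lim s - s (2 ^ k0)) \<le> (\<Sum>i. D (i + k0))"
          using dyadic_convergent[OF D(2,1) s] by auto
        \<comment> \<open>The symmetric partial sum up to N is s (N + 1); the shift does not change
          the limit.\<close>
        have "(\<lambda>N. s (Suc N)) \<longlonglongrightarrow> lim s"
          using conv by (intro LIMSEQ_Suc) (simp add: convergent_LIMSEQ_iff)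
        then have "lim (\<lambda>N. s (Suc N)) = lim s"
          by (rule limI)
        moreover have "(\<Sum>i. D (i + k0)) \<le> (\<Sum>i. D i)"
          using suminf_split_initial_segment[OF D(1), of k0] D(2) by (simp add: sum_nonneg)
        moreover have "(\<Sum>i. D i) = \<delta> / sqrt \<epsilon>"
          using r unfolding D_def by (subst suminf_mult) (auto simp: suminf_geometric summable_geometric d_def)
        ultimately show ?thesis
          using lim by (simp add: s_def)
      qed
      show "\<exists>B\<in>events. prob B \<le> C / \<epsilon> * exp (- (A / \<epsilon>)) \<and>
    (\<forall>\<omega>\<in>space M - B. \<forall>t x. 0 \<le> t \<longrightarrow> t \<le> K / \<epsilon> \<longrightarrow> 0 \<le> x \<longrightarrow> x \<le> 2 * pi \<longrightarrow>
       cmod (lim (\<lambda>N. \<Sum>n\<in>freq (Suc N). wave \<theta> \<epsilon> t x n (g n \<omega>)) - (\<Sum>n\<in>freq (2 ^ k0). wave \<theta> \<epsilon> t x n (g n \<omega>))) \<le> \<delta> / sqrt \<epsilon>)"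
        using B prob good by blast
    qed
  qed
  then show ?thesis
    by (rule that)
qed

end

section \<open>The large deviation principle\<close>

text \<open>Replaces an essential supremum by the measure of a superlevel set. Measurability of the
  event and both probability estimates go through this form.\<close>

lemma less_esssup_iff:
  assumes f: "f \<in> borel_measurable M"
  shows "c < esssup M f \<longleftrightarrow> emeasure M {x \<in> space M. c < f x} \<noteq> 0"
proof
  assume c: "c < esssup M f"
  show "emeasure M {x \<in> space M. c < f x} \<noteq> 0"
  proof
    assume "emeasure M {x \<in> space M. c < f x} = 0"
    then have "AE x in M. f x \<le> c"
      using f by (subst AE_iff_measurable[OF _ refl]) (auto simp: not_le)
    with c show False
      using esssup_I[OF f] by (simp add: not_le[symmetric])
  qed
next
  assume c: "emeasure M {x \<in> space M. c < f x} \<noteq> 0"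
  show "c < esssup M f"
  proof (rule ccontr)
    assume "\<not> c < esssup M f"
    then have "emeasure M {x \<in> space M. c < f x} \<le> emeasure M {x \<in> space M. esssup M f < f x}"
      using f by (intro emeasure_mono) auto
    with c show False
      by (simp add: esssup_zero_measure)
  qed
qed

text \<open>The prefactors contribute only \<epsilon> ln(Q / \<epsilon>) and \<epsilon> ln Q, which
  tend to 0. The constants may depend on \<eta>, because \<eta> is fixed before \<epsilon> tends to
  0.\<close>

lemma log_asymptotics:
  fixes p :: "real \<Rightarrow> real"
  assumes upper: "\<And>\<eta>. \<eta> > 0 \<Longrightarrow> \<exists>Q>0. \<forall>\<^sub>F \<epsilon> in at_right 0. p \<epsilon> \<le> Q / \<epsilon> * exp (- ((A - \<eta>) / \<epsilon>))"
    and lower: "\<And>\<eta>. \<eta> > 0 \<Longrightarrow> \<exists>Q>0. \<forall>\<^sub>F \<epsilon> in at_right 0. Q * exp (- ((A + \<eta>) / \<epsilon>)) \<le> p \<epsilon>"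
  shows "((\<lambda>\<epsilon>. \<epsilon> * ln (p \<epsilon>)) \<longlongrightarrow> - A) (at_right 0)"
proof (rule tendstoI)
  fix e :: real assume e: "e > 0"
  then obtain Q1 where Q1: "Q1 > 0" "\<forall>\<^sub>F \<epsilon> in at_right 0. p \<epsilon> \<le> Q1 / \<epsilon> * exp (- ((A - e / 2) / \<epsilon>))"
    using upper[of "e / 2"] by auto
  from e obtain Q2 where Q2: "Q2 > 0" "\<forall>\<^sub>F \<epsilon> in at_right 0. Q2 * exp (- ((A + e / 2) / \<epsilon>)) \<le> p \<epsilon>"
    using lower[of "e / 2"] by auto
  have "((\<lambda>\<epsilon>. \<epsilon> * ln (Q1 / \<epsilon>)) \<longlongrightarrow> 0) (at_right 0)"
    using Q1(1) by real_asymp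
  then have l1: "\<forall>\<^sub>F \<epsilon> in at_right 0. \<epsilon> * ln (Q1 / \<epsilon>) < e / 2"
    using e by (intro order_tendstoD) auto
  have "((\<lambda>\<epsilon>. \<epsilon> * ln Q2) \<longlongrightarrow> 0) (at_right 0)"
    by real_asymp
  then have l2: "\<forall>\<^sub>F \<epsilon> in at_right 0. - (e / 2) < \<epsilon> * ln Q2"
    using e by (intro order_tendstoD) auto
  have "\<forall>\<^sub>F \<epsilon> in at_right 0. (0::real) < \<epsilon>"
    by (simp add: eventually_at_right_less)
  with Q1(2) Q2(2) l1 l2 show "\<forall>\<^sub>F \<epsilon> in at_right 0. dist (\<epsilon> * ln (p \<epsilon>)) (- A) < e"
  proof eventually_elim
    case (elim \<epsilon>)
    \<comment> \<open>The lower bound makes \<open>p\<close> positive, so the value of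
      \<open>ln\<close> at 0 never enters.\<close>
    have p: "p \<epsilon> > 0"
      by (rule less_le_trans[OF _ elim(2)]) (simp add: Q2(1))
    have "ln (p \<epsilon>) \<le> ln (Q1 / \<epsilon> * exp (- ((A - e / 2) / \<epsilon>)))"
      using elim(1) p by simp
    also have "\<dots> = ln (Q1 / \<epsilon>) - (A - e / 2) / \<epsilon>"
      using Q1(1) elim(5) by (subst ln_mult) auto
    finally have "\<epsilon> * ln (p \<epsilon>) \<le> \<epsilon> * (ln (Q1 / \<epsilon>) - (A - e / 2) / \<epsilon>)"
      using elim(5) by (intro mult_left_mono) auto
    also have "\<dots> = \<epsilon> * ln (Q1 / \<epsilon>) - (A - e / 2)"
      using elim(5) by (simp add: field_simps)
    finally have "\<epsilon> * ln (p \<epsilon>) \<le> \<epsilon> * ln (Q1 / \<epsilon>) - (A - e / 2)" .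
    moreover have "ln (Q2 * exp (- ((A + e / 2) / \<epsilon>))) \<le> ln (p \<epsilon>)"
      using elim(2) p Q2(1) by simp
    then have "ln Q2 - (A + e / 2) / \<epsilon> \<le> ln (p \<epsilon>)"
      using Q2(1) by (subst (asm) ln_mult) auto
    then have "\<epsilon> * (ln Q2 - (A + e / 2) / \<epsilon>) \<le> \<epsilon> * ln (p \<epsilon>)"
      using elim(5) by (intro mult_left_mono) auto
    then have "\<epsilon> * ln Q2 - (A + e / 2) \<le> \<epsilon> * ln (p \<epsilon>)"
      using elim(5) by (simp add: right_diff_distrib)
    ultimately show ?case
      using elim(3,4) by (simp add: dist_real_def abs_less_iff)
  qed
qed

context gaussian_family
begin

section \<open>Measurability of the large-value event and pointwise criteria for it\<close>

definition large_event :: "real \<Rightarrow> real \<Rightarrow> real \<Rightarrow> real \<Rightarrow> 'a set" where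
  "large_event \<theta> T \<epsilon> a = {\<omega> \<in> space M. Linf_norm T (u_app \<theta> (\<lambda>n. g n \<omega>) \<epsilon>) > ereal a}"

abbreviation spacetime :: "real \<Rightarrow> (real \<times> real) measure" where
  "spacetime T \<equiv> restrict_space lborel ({0..T} \<times> {0..2 * pi})"

lemma spacetime_box [simp]: "{0..T} \<times> {0..2 * pi} \<in> sets (borel :: (real \<times> real) measure)"
  by (intro borel_closed closed_Times) auto

text \<open>\<open>cmod_u_app\<close> removes the L2 norm of \<open>u0\<close>, whose dependence on
  \<omega> would otherwise have to be studied. What remains is \<open>lim\<close> of measurable
  partial sums, measurable also where they diverge.\<close>

lemma u_app_jointly_measurable [measurable]:
  "(\<lambda>(\<omega>, p). cmod (u_app \<theta> (\<lambda>n. g n \<omega>) \<epsilon> (fst p) (snd p))) \<in> borel_measurable (M \<Otimes>\<^sub>M spacetime T)"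
proof -
  have [measurable]: "fst \<in> borel_measurable (spacetime T)" "snd \<in> borel_measurable (spacetime T)"
    by (auto intro!: measurable_restrict_space1 borel_measurable_continuous_onI continuous_intros)
  show ?thesis
    unfolding cmod_u_app split_beta wave_def phase_def by measurable
qed

lemma less_Linf_norm_iff:
  assumes "\<omega> \<in> space M"
  shows "ereal a < Linf_norm T (u_app \<theta> (\<lambda>n. g n \<omega>) \<epsilon>) \<longleftrightarrow>
    emeasure (spacetime T) {p \<in> space (spacetime T). a < cmod (u_app \<theta> (\<lambda>n. g n \<omega>) \<epsilon> (fst p) (snd p))} \<noteq> 0"
proof -
  have "(\<lambda>p. cmod (u_app \<theta> (\<lambda>n. g n \<omega>) \<epsilon> (fst p) (snd p))) \<in> borel_measurable (spacetime T)"
    using measurable_compose[OF measurable_Pair1'[OF assms] u_app_jointly_measurable] by simp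
  then show ?thesis
    unfolding Linf_norm_def by (subst less_esssup_iff) auto
qed

text \<open>A supremum over uncountably many points need not be measurable. The measure of the
  section of a jointly measurable set is, since the space-time box is sigma-finite.\<close>

lemma large_event_events [measurable]: "large_event \<theta> T \<epsilon> a \<in> events"
proof -
  let ?f = "\<lambda>\<omega> p. cmod (u_app \<theta> (\<lambda>n. g n \<omega>) \<epsilon> (fst p) (snd p))"
  interpret R: sigma_finite_measure "spacetime T"
    by (intro sigma_finite_measure_restrict_space) (auto simp: lborel.sigma_finite_measure_axioms)
  define Q where "Q = {z \<in> space (M \<Otimes>\<^sub>M spacetime T). a < (case z of (\<omega>, p) \<Rightarrow> ?f \<omega> p)}"
  have Q: "Q \<in> sets (M \<Otimes>\<^sub>M spacetime T)"
    unfolding Q_def by measurable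
  have "large_event \<theta> T \<epsilon> a = {\<omega> \<in> space M. emeasure (spacetime T) (Pair \<omega> -` Q) \<noteq> 0}"
  proof -
    have "Pair \<omega> -` Q = {p \<in> space (spacetime T). a < ?f \<omega> p}" if "\<omega> \<in> space M" for \<omega>
      using that by (auto simp: Q_def space_pair_measure)
    then show ?thesis
      by (auto simp: large_event_def less_Linf_norm_iff)
  qed
  moreover have [measurable]: "(\<lambda>\<omega>. emeasure (spacetime T) (Pair \<omega> -` Q)) \<in> borel_measurable M"
    by (rule R.measurable_emeasure_Pair[OF Q])
  ultimately show ?thesis
    by simp
qed

lemma not_in_large_event:
  assumes "\<omega> \<in> space M"
    and "\<And>t x. \<lbrakk>0 \<le> t; t \<le> T; 0 \<le> x; x \<le> 2 * pi\<rbrakk> \<Longrightarrow> cmod (u_app \<theta> (\<lambda>n. g n \<omega>) \<epsilon> t x) \<le> a"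
  shows "\<omega> \<notin> large_event \<theta> T \<epsilon> a"
proof -
  have "{p \<in> space (spacetime T). a < cmod (u_app \<theta> (\<lambda>n. g n \<omega>) \<epsilon> (fst p) (snd p))} = {}"
    using assms(2) by (force simp: space_restrict_space not_less[symmetric])
  then show ?thesis
    using assms(1) by (simp add: large_event_def less_Linf_norm_iff del: Collect_empty_eq)
qed

text \<open>A large value at one point is invisible to an essential supremum; a square of side
  \<eta> has positive area and is seen.\<close>

lemma in_large_event:
  assumes \<omega>: "\<omega> \<in> space M" and \<eta>: "0 < \<eta>" "\<eta> \<le> T" "\<eta> \<le> 2 * pi"
    and gt: "\<And>t x. \<lbrakk>0 \<le> t; t \<le> \<eta>; 0 \<le> x; x \<le> \<eta>\<rbrakk> \<Longrightarrow> a < cmod (u_app \<theta> (\<lambda>n. g n \<omega>) \<epsilon> t x)"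
  shows "\<omega> \<in> large_event \<theta> T \<epsilon> a"
proof -
  let ?f = "\<lambda>p. cmod (u_app \<theta> (\<lambda>n. g n \<omega>) \<epsilon> (fst p) (snd p))"
  have [measurable]: "?f \<in> borel_measurable (spacetime T)"
    using measurable_compose[OF measurable_Pair1'[OF \<omega>] u_app_jointly_measurable] by simp
  have sub: "{0..\<eta>} \<times> {0..\<eta>} \<subseteq> {p \<in> space (spacetime T). a < ?f p}"
    using gt \<eta> by (auto simp: space_restrict_space)
  have "emeasure lborel ({0..\<eta>} \<times> {0..\<eta>}) = ennreal \<eta> * ennreal \<eta>"
    using \<eta> by (simp add: lborel_prod[symmetric] lborel.emeasure_pair_measure_Times)
  also have "\<dots> > 0"
    using \<eta> by (simp add: ennreal_mult[symmetric])
  also have "emeasure lborel ({0..\<eta>} \<times> {0..\<eta>}) = emeasure (spacetime T) ({0..\<eta>} \<times> {0..\<eta>})"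
    using \<eta> by (subst emeasure_restrict_space) auto
  also have "\<dots> \<le> emeasure (spacetime T) {p \<in> space (spacetime T). a < ?f p}"
    using sub by (intro emeasure_mono) measurable
  finally show ?thesis
    using \<omega> by (simp add: large_event_def less_Linf_norm_iff)
qed

section \<open>Upper and lower exponential bounds for the large-value event\<close>

lemma weighted_sum_tail:
  assumes "\<theta> > 0" and A: "finite A" and \<mu>: "0 < \<mu>" "\<mu> < 1" and y: "y \<ge> 0"
  shows "prob {\<omega> \<in> space M. y \<le> (\<Sum>n\<in>A. coeff_c \<theta> n * cmod (g n \<omega>))}
    \<le> exp (- \<mu> * (y\<^sup>2 / mass \<theta>)) * (1 / (1 - \<mu>)) ^ card A"
proof -
  have S: "mass \<theta> > 0"
    using mass_ge_1[OF assms(1)] by simp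
  have "y\<^sup>2 / mass \<theta> \<le> (\<Sum>n\<in>A. (cmod (g n \<omega>))\<^sup>2)" if "y \<le> (\<Sum>n\<in>A. coeff_c \<theta> n * cmod (g n \<omega>))" for \<omega>
  proof -
    have "y\<^sup>2 \<le> (\<Sum>n\<in>A. coeff_c \<theta> n * cmod (g n \<omega>))\<^sup>2"
      using that y by (intro power_mono)
    also have "\<dots> \<le> (\<Sum>n\<in>A. (coeff_c \<theta> n)\<^sup>2) * (\<Sum>n\<in>A. (cmod (g n \<omega>))\<^sup>2)"
      by (rule Cauchy_Schwarz_ineq_sum)
    \<comment> \<open>Enlarging the partial sum to the full mass makes the rate independent of
      \<open>A\<close>, hence of the cutoff; only the prefactor sees the number of
      frequencies.\<close>
    also have "\<dots> \<le> mass \<theta> * (\<Sum>n\<in>A. (cmod (g n \<omega>))\<^sup>2)"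
      using sum_coeff_c_le_mass[OF assms(1) A] by (intro mult_right_mono sum_nonneg) auto
    finally show ?thesis
      using S by (simp add: field_simps)
  qed
  then have "prob {\<omega> \<in> space M. y \<le> (\<Sum>n\<in>A. coeff_c \<theta> n * cmod (g n \<omega>))}
      \<le> prob {\<omega> \<in> space M. y\<^sup>2 / mass \<theta> \<le> (\<Sum>n\<in>A. (cmod (g n \<omega>))\<^sup>2)}"
    by (intro finite_measure_mono) auto
  also have "\<dots> \<le> exp (- \<mu> * (y\<^sup>2 / mass \<theta>)) * (1 / (1 - \<mu>)) ^ card A"
    by (rule square_sum_tail[OF A \<mu>])
  finally show ?thesis .
qed

text \<open>One parameter \<tau> measures both losses: \<tau> / sqrt \<epsilon> is conceded to the
  tail, and 1 - \<tau> is the Chernoff parameter of the low frequencies. The rate (1 - \<tau>) (z -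
  \<tau>)^2 / S tends to z^2 / S as \<tau> tends to 0.\<close>

lemma large_event_upper:
  assumes "\<theta> > 0" "z > 0" and T: "\<And>\<epsilon>. \<epsilon> > 0 \<Longrightarrow> T \<epsilon> \<le> K / \<epsilon>" and K: "K > 0" and \<eta>: "\<eta> > 0"
  shows "\<exists>Q>0. \<forall>\<^sub>F \<epsilon> in at_right 0. prob (large_event \<theta> (T \<epsilon>) \<epsilon> (z / sqrt \<epsilon>)) \<le> Q / \<epsilon> * exp (- ((z\<^sup>2 / mass \<theta> - \<eta>) / \<epsilon>))"
proof -
  define A where "A = z\<^sup>2 / mass \<theta>"
  have S: "mass \<theta> > 0"
    using mass_ge_1[OF assms(1)] by simp
  have "((\<lambda>\<tau>. (1 - \<tau>) * ((z - \<tau>)\<^sup>2 / mass \<theta>)) \<longlongrightarrow> (1 - 0) * ((z - 0)\<^sup>2 / mass \<theta>)) (at_right 0)"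
    using S by (intro tendsto_intros) auto
  then have "\<forall>\<^sub>F \<tau> in at_right 0. A - \<eta> < (1 - \<tau>) * ((z - \<tau>)\<^sup>2 / mass \<theta>)"
    using \<eta> by (intro order_tendstoD) (auto simp: A_def)
  moreover have "\<forall>\<^sub>F \<tau> in at_right 0. \<tau> \<in> {0<..<min 1 z}"
    using assms by (intro eventually_at_right_real) auto
  ultimately have "\<forall>\<^sub>F \<tau> in at_right 0. A - \<eta> < (1 - \<tau>) * ((z - \<tau>)\<^sup>2 / mass \<theta>) \<and> \<tau> \<in> {0<..<min 1 z}"
    by (rule eventually_conj)
  then obtain \<tau> where \<tau>: "A - \<eta> < (1 - \<tau>) * ((z - \<tau>)\<^sup>2 / mass \<theta>)" "0 < \<tau>" "\<tau> < 1" "\<tau> < z"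
    using eventually_happens[of _ "at_right (0::real)"] by auto
  \<comment> \<open>The exponent \<open>A\<close> demanded of the tail already exceeds the target A
    - \<eta>, so the exceptional event is no obstacle.\<close>
  obtain C where C: "\<forall>\<^sub>F k0 in sequentially. \<forall>\<epsilon>. 0 < \<epsilon> \<longrightarrow> \<epsilon> \<le> 1 \<longrightarrow> (\<exists>B\<in>events. prob B \<le> C / \<epsilon> * exp (- (A / \<epsilon>)) \<and>
    (\<forall>\<omega>\<in>space M - B. \<forall>t x. 0 \<le> t \<longrightarrow> t \<le> K / \<epsilon> \<longrightarrow> 0 \<le> x \<longrightarrow> x \<le> 2 * pi \<longrightarrow>
       cmod (lim (\<lambda>N. \<Sum>n\<in>freq (Suc N). wave \<theta> \<epsilon> t x n (g n \<omega>)) - (\<Sum>n\<in>freq (2 ^ k0). wave \<theta> \<epsilon> t x n (g n \<omega>))) \<le> \<tau> / sqrt \<epsilon>))"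
    by (rule tail_control[OF assms(1) \<tau>(2) K, of A])
  from eventually_happens[OF C] obtain k0 where
    k0: "\<And>\<epsilon>. 0 < \<epsilon> \<Longrightarrow> \<epsilon> \<le> 1 \<Longrightarrow> (\<exists>B\<in>events. prob B \<le> C / \<epsilon> * exp (- (A / \<epsilon>)) \<and>
    (\<forall>\<omega>\<in>space M - B. \<forall>t x. 0 \<le> t \<longrightarrow> t \<le> K / \<epsilon> \<longrightarrow> 0 \<le> x \<longrightarrow> x \<le> 2 * pi \<longrightarrow>
       cmod (lim (\<lambda>N. \<Sum>n\<in>freq (Suc N). wave \<theta> \<epsilon> t x n (g n \<omega>)) - (\<Sum>n\<in>freq (2 ^ k0). wave \<theta> \<epsilon> t x n (g n \<omega>))) \<le> \<tau> / sqrt \<epsilon>))"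
    by auto
  \<comment> \<open>The prefactor of \<open>weighted_sum_tail\<close> at \<mu> = 1 - \<tau>.\<close>
  define D where "D = (1 / \<tau>) ^ card (freq (2 ^ k0))"
  have D: "D > 0"
    using \<tau> by (simp add: D_def)
  have "prob (large_event \<theta> (T \<epsilon>) \<epsilon> (z / sqrt \<epsilon>)) \<le> (\<bar>C\<bar> + D) / \<epsilon> * exp (- ((A - \<eta>) / \<epsilon>))"
    if \<epsilon>: "0 < \<epsilon>" "\<epsilon> \<le> 1" for \<epsilon>
  proof -
    obtain B where B: "B \<in> events" "prob B \<le> C / \<epsilon> * exp (- (A / \<epsilon>))"
      "\<And>\<omega> t x. \<lbrakk>\<omega> \<in> space M - B; 0 \<le> t; t \<le> K / \<epsilon>; 0 \<le> x; x \<le> 2 * pi\<rbrakk> \<Longrightarrow>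
       cmod (lim (\<lambda>N. \<Sum>n\<in>freq (Suc N). wave \<theta> \<epsilon> t x n (g n \<omega>)) - (\<Sum>n\<in>freq (2 ^ k0). wave \<theta> \<epsilon> t x n (g n \<omega>))) \<le> \<tau> / sqrt \<epsilon>"
      using k0[OF \<epsilon>] by blast
    define y where "y = (z - \<tau>) / sqrt \<epsilon>"
    let ?E = "{\<omega> \<in> space M. y \<le> (\<Sum>n\<in>freq (2 ^ k0). coeff_c \<theta> n * cmod (g n \<omega>))}"
    have "large_event \<theta> (T \<epsilon>) \<epsilon> (z / sqrt \<epsilon>) \<subseteq> B \<union> ?E"
    proof (rule subsetI, rule ccontr)
      fix \<omega> assume \<omega>: "\<omega> \<in> large_event \<theta> (T \<epsilon>) \<epsilon> (z / sqrt \<epsilon>)" and n: "\<omega> \<notin> B \<union> ?E"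
      then have sp: "\<omega> \<in> space M"
        by (simp add: large_event_def)
      have "\<omega> \<notin> large_event \<theta> (T \<epsilon>) \<epsilon> (z / sqrt \<epsilon>)"
      proof (rule not_in_large_event[OF sp])
        fix t x assume tx: "0 \<le> t" "t \<le> T \<epsilon>" "0 \<le> x" "x \<le> 2 * pi"
        let ?l = "lim (\<lambda>N. \<Sum>n\<in>freq (Suc N). wave \<theta> \<epsilon> t x n (g n \<omega>))"
        let ?s = "\<Sum>n\<in>freq (2 ^ k0). wave \<theta> \<epsilon> t x n (g n \<omega>)"
        have "cmod (?l - ?s) \<le> \<tau> / sqrt \<epsilon>"
          using B(3)[of \<omega> t x] n sp tx T[OF \<epsilon>(1)] by auto
        moreover have "cmod ?s \<le> y"
          using n sp by (intro order_trans[OF norm_sum]) (auto simp: cmod_wave)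
        moreover have "cmod ?l \<le> cmod (?l - ?s) + cmod ?s"
          using norm_triangle_ineq[of "?l - ?s" ?s] by simp
        ultimately have "cmod ?l \<le> \<tau> / sqrt \<epsilon> + y"
          by linarith
        also have "\<dots> = z / sqrt \<epsilon>"
          by (simp add: y_def add_divide_distrib[symmetric])
        finally show "cmod (u_app \<theta> (\<lambda>n. g n \<omega>) \<epsilon> t x) \<le> z / sqrt \<epsilon>"
          by (simp add: cmod_u_app)
      qed
      with \<omega> show False by blast
    qed
    then have "prob (large_event \<theta> (T \<epsilon>) \<epsilon> (z / sqrt \<epsilon>)) \<le> prob (B \<union> ?E)"
      using B by (intro finite_measure_mono) auto
    also have "\<dots> \<le> prob B + prob ?E"
      using B by (intro measure_Un_le) auto
    also have "\<dots> \<le> \<bar>C\<bar> / \<epsilon> * exp (- ((A - \<eta>) / \<epsilon>)) + D / \<epsilon> * exp (- ((A - \<eta>) / \<epsilon>))"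
    proof (rule add_mono)
      \<comment> \<open>The absolute value is taken because \<open>tail_control\<close> gives no
        sign for \<open>C\<close>.\<close>
      have "C / \<epsilon> * exp (- (A / \<epsilon>)) \<le> \<bar>C\<bar> / \<epsilon> * exp (- ((A - \<eta>) / \<epsilon>))"
        using \<epsilon> \<eta> by (intro mult_mono divide_right_mono) (auto simp: divide_right_mono)
      with B(2) show "prob B \<le> \<bar>C\<bar> / \<epsilon> * exp (- ((A - \<eta>) / \<epsilon>))"
        by linarith
      have "prob ?E \<le> exp (- (1 - \<tau>) * (y\<^sup>2 / mass \<theta>)) * (1 / (1 - (1 - \<tau>))) ^ card (freq (2 ^ k0))"
        using \<tau> \<epsilon> by (intro weighted_sum_tail assms) (auto simp: y_def)
      also have "- (1 - \<tau>) * (y\<^sup>2 / mass \<theta>) = - ((1 - \<tau>) * ((z - \<tau>)\<^sup>2 / mass \<theta>) / \<epsilon>)"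
        using \<epsilon> S by (simp add: y_def power_divide field_simps)
      also have "(1 / (1 - (1 - \<tau>))) ^ card (freq (2 ^ k0)) = D"
        by (simp add: D_def)
      also have "exp (- ((1 - \<tau>) * ((z - \<tau>)\<^sup>2 / mass \<theta>) / \<epsilon>)) * D \<le> exp (- ((A - \<eta>) / \<epsilon>)) * D"
        using divide_right_mono[OF less_imp_le[OF \<tau>(1)], of \<epsilon>] \<epsilon> D by (intro mult_right_mono) auto
      finally have "prob ?E \<le> D * exp (- ((A - \<eta>) / \<epsilon>))"
        by (simp add: mult.commute)
      also have "\<dots> \<le> D / \<epsilon> * exp (- ((A - \<eta>) / \<epsilon>))"
        using D \<epsilon> by (intro mult_right_mono) (auto simp: field_simps)
      finally show "prob ?E \<le> D / \<epsilon> * exp (- ((A - \<eta>) / \<epsilon>))" .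
    qed
    finally show ?thesis
      by (simp add: add_divide_distrib distrib_right)
  qed
  moreover have "\<forall>\<^sub>F \<epsilon> in at_right 0. \<epsilon> \<in> {0<..<1::real}"
    by (intro eventually_at_right_real) auto
  ultimately have "\<forall>\<^sub>F \<epsilon> in at_right 0. prob (large_event \<theta> (T \<epsilon>) \<epsilon> (z / sqrt \<epsilon>)) \<le> (\<bar>C\<bar> + D) / \<epsilon> * exp (- ((A - \<eta>) / \<epsilon>))"
    by (auto elim: eventually_mono)
  moreover have "\<bar>C\<bar> + D > 0"
    using D by simp
  ultimately show ?thesis
    unfolding A_def by blast
qed

text \<open>The real part at the origin is required to exceed (z + \<tau>) / sqrt \<epsilon>, so
  that a tail of size \<tau> / sqrt \<epsilon> cannot bring the modulus back below the level. The
  exceptional event of the tail is subtracted.\<close>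

lemma large_event_lower:
  assumes "\<theta> > 0" "z > 0" and T: "\<And>\<epsilon>. \<epsilon> > 0 \<Longrightarrow> T \<epsilon> \<le> K / \<epsilon>" "\<And>\<epsilon>. \<epsilon> > 0 \<Longrightarrow> T \<epsilon> > 0"
    and K: "K > 0" and \<eta>: "\<eta> > 0"
  shows "\<exists>Q>0. \<forall>\<^sub>F \<epsilon> in at_right 0. Q * exp (- ((z\<^sup>2 / mass \<theta> + \<eta>) / \<epsilon>)) \<le> prob (large_event \<theta> (T \<epsilon>) \<epsilon> (z / sqrt \<epsilon>))"
proof -
  define A where "A = z\<^sup>2 / mass \<theta>"
  have S: "mass \<theta> > 0"
    using mass_ge_1[OF assms(1)] by simp
  have "((\<lambda>\<tau>. (z + \<tau>)\<^sup>2 / mass \<theta>) \<longlongrightarrow> (z + 0)\<^sup>2 / mass \<theta>) (at_right 0)"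
    using S by (intro tendsto_intros) auto
  then have "\<forall>\<^sub>F \<tau> in at_right 0. (z + \<tau>)\<^sup>2 / mass \<theta> < A + \<eta>"
    using \<eta> by (intro order_tendstoD) (auto simp: A_def)
  moreover have "\<forall>\<^sub>F \<tau> in at_right 0. (0::real) < \<tau>"
    by (simp add: eventually_at_right_less)
  ultimately have "\<forall>\<^sub>F \<tau> in at_right 0. (z + \<tau>)\<^sup>2 / mass \<theta> < A + \<eta> \<and> 0 < \<tau>"
    by (rule eventually_conj)
  then obtain \<tau> where \<tau>: "(z + \<tau>)\<^sup>2 / mass \<theta> < A + \<eta>" "0 < \<tau>"
    using eventually_happens[of _ "at_right (0::real)"] by auto
  \<comment> \<open>The exponent exceeds the target A + \<eta> by 1, so the probability of the
    exceptional event is smaller than the main term by a factor of order exp(-1 / \<epsilon>) /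
    \<epsilon>; subtracting it eventually costs at most half of \<open>q\<close>.\<close>
  obtain C where C: "\<forall>\<^sub>F k0 in sequentially. \<forall>\<epsilon>. 0 < \<epsilon> \<longrightarrow> \<epsilon> \<le> 1 \<longrightarrow> (\<exists>B\<in>events. prob B \<le> C / \<epsilon> * exp (- ((A + \<eta> + 1) / \<epsilon>)) \<and>
    (\<forall>\<omega>\<in>space M - B. \<forall>t x. 0 \<le> t \<longrightarrow> t \<le> K / \<epsilon> \<longrightarrow> 0 \<le> x \<longrightarrow> x \<le> 2 * pi \<longrightarrow>
       cmod (lim (\<lambda>N. \<Sum>n\<in>freq (Suc N). wave \<theta> \<epsilon> t x n (g n \<omega>)) - (\<Sum>n\<in>freq (2 ^ k0). wave \<theta> \<epsilon> t x n (g n \<omega>))) \<le> \<tau> / sqrt \<epsilon>))"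
    by (rule tail_control[OF assms(1) \<tau>(2) K, of "A + \<eta> + 1"])
  have "(\<lambda>k. (z + \<tau>)\<^sup>2 / (\<Sum>n\<in>freq (2 ^ k). (coeff_c \<theta> n)\<^sup>2)) \<longlonglongrightarrow> (z + \<tau>)\<^sup>2 / mass \<theta>"
    using S by (intro tendsto_intros freq_sum_tendsto_mass assms) auto
  then have "\<forall>\<^sub>F k in sequentially. (z + \<tau>)\<^sup>2 / (\<Sum>n\<in>freq (2 ^ k). (coeff_c \<theta> n)\<^sup>2) < A + \<eta>"
    using \<tau>(1) by (rule order_tendstoD)
  \<comment> \<open>Since \<open>C\<close> precedes \<open>k0\<close>, the cutoff can also be taken
    large enough for the partial mass to give a rate below A + \<eta>.\<close>
  from eventually_happens[OF eventually_conj[OF this C]] obtain k0 where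
    s: "(z + \<tau>)\<^sup>2 / (\<Sum>n\<in>freq (2 ^ k0). (coeff_c \<theta> n)\<^sup>2) < A + \<eta>" and
    k0: "\<And>\<epsilon>. 0 < \<epsilon> \<Longrightarrow> \<epsilon> \<le> 1 \<Longrightarrow> (\<exists>B\<in>events. prob B \<le> C / \<epsilon> * exp (- ((A + \<eta> + 1) / \<epsilon>)) \<and>
    (\<forall>\<omega>\<in>space M - B. \<forall>t x. 0 \<le> t \<longrightarrow> t \<le> K / \<epsilon> \<longrightarrow> 0 \<le> x \<longrightarrow> x \<le> 2 * pi \<longrightarrow>
       cmod (lim (\<lambda>N. \<Sum>n\<in>freq (Suc N). wave \<theta> \<epsilon> t x n (g n \<omega>)) - (\<Sum>n\<in>freq (2 ^ k0). wave \<theta> \<epsilon> t x n (g n \<omega>))) \<le> \<tau> / sqrt \<epsilon>))"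
    by auto
  define s where "s = (\<Sum>n\<in>freq (2 ^ k0). (coeff_c \<theta> n)\<^sup>2)"
  have ne: "freq (2 ^ k0) \<noteq> {}"
    by (auto simp: freq_def intro!: exI[of _ 0])
  have s0: "s > 0"
    unfolding s_def using ne coeff_c_pos by (intro sum_pos zero_less_power) auto
  define q where "q = 1 / sqrt (pi * s)"
  have q: "q > 0"
    using s0 by (simp add: q_def)
  have lower: "q * exp (- ((((z + \<tau>) + sqrt \<epsilon>)\<^sup>2 / s) / \<epsilon>)) - C / \<epsilon> * exp (- ((A + \<eta> + 1) / \<epsilon>))
      \<le> prob (large_event \<theta> (T \<epsilon>) \<epsilon> (z / sqrt \<epsilon>))"
    if \<epsilon>: "0 < \<epsilon>" "\<epsilon> \<le> 1" for \<epsilon>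
  proof -
    obtain B where B: "B \<in> events" "prob B \<le> C / \<epsilon> * exp (- ((A + \<eta> + 1) / \<epsilon>))"
      "\<And>\<omega> t x. \<lbrakk>\<omega> \<in> space M - B; 0 \<le> t; t \<le> K / \<epsilon>; 0 \<le> x; x \<le> 2 * pi\<rbrakk> \<Longrightarrow>
       cmod (lim (\<lambda>N. \<Sum>n\<in>freq (Suc N). wave \<theta> \<epsilon> t x n (g n \<omega>)) - (\<Sum>n\<in>freq (2 ^ k0). wave \<theta> \<epsilon> t x n (g n \<omega>))) \<le> \<tau> / sqrt \<epsilon>"
      using k0[OF \<epsilon>] by blast
    define y where "y = (z + \<tau>) / sqrt \<epsilon>"
    let ?E = "{\<omega> \<in> space M. y < Re (\<Sum>n\<in>freq (2 ^ k0). of_real (coeff_c \<theta> n) * g n \<omega>)}"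
    have "?E - B \<subseteq> large_event \<theta> (T \<epsilon>) \<epsilon> (z / sqrt \<epsilon>)"
    proof
      fix \<omega> assume "\<omega> \<in> ?E - B"
      then have \<omega>: "\<omega> \<in> space M" "\<omega> \<notin> B" and y: "y < Re (\<Sum>n\<in>freq (2 ^ k0). of_real (coeff_c \<theta> n) * g n \<omega>)"
        by auto
      define F where "F p = (\<Sum>n\<in>freq (2 ^ k0). wave \<theta> \<epsilon> (fst p) (snd p) n (g n \<omega>))" for p
      have "continuous_on UNIV (\<lambda>p. cmod (F p))"
        unfolding F_def wave_def phase_def by (intro continuous_intros)
      then have "open {p. y < cmod (F p)}"
        by (intro open_Collect_less continuous_on_const)
      moreover have "(0, 0) \<in> {p. y < cmod (F p)}"
        using y complex_Re_le_cmod[of "F (0, 0)"] by (simp add: F_def wave_def phase_def)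
      ultimately obtain e where e: "e > 0" "ball (0, 0) e \<subseteq> {p. y < cmod (F p)}"
        using open_contains_ball by blast
      \<comment> \<open>With e / 3 both coordinates together stay below e; the other two terms keep
        the square inside the box. The side depends on \<omega> without a uniform lower bound, which
        is harmless because only positive area matters.\<close>
      define \<eta>' where "\<eta>' = min (e / 3) (min (T \<epsilon>) (2 * pi))"
      show "\<omega> \<in> large_event \<theta> (T \<epsilon>) \<epsilon> (z / sqrt \<epsilon>)"
      proof (rule in_large_event[OF \<omega>(1)])
        show "0 < \<eta>'" "\<eta>' \<le> T \<epsilon>" "\<eta>' \<le> 2 * pi"
          using e(1) T(2)[OF \<epsilon>(1)] by (auto simp: \<eta>'_def)
        fix t x assume tx: "0 \<le> t" "t \<le> \<eta>'" "0 \<le> x" "x \<le> \<eta>'"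
        have "norm (t, x) \<le> norm t + norm x"
          by (rule norm_Pair_le)
        also have "\<dots> < e"
          using tx e(1) by (simp add: \<eta>'_def)
        finally have "(t, x) \<in> ball (0, 0) e"
          by (simp add: dist_Pair_Pair norm_Pair dist_norm)
        then have "y < cmod (F (t, x))"
          using e(2) by blast
        moreover have "cmod (lim (\<lambda>N. \<Sum>n\<in>freq (Suc N). wave \<theta> \<epsilon> t x n (g n \<omega>)) - F (t, x)) \<le> \<tau> / sqrt \<epsilon>"
          using B(3)[of \<omega> t x] \<omega> tx T(1)[OF \<epsilon>(1)] by (simp add: F_def \<eta>'_def)
        moreover have "cmod (F (t, x)) \<le> cmod (lim (\<lambda>N. \<Sum>n\<in>freq (Suc N). wave \<theta> \<epsilon> t x n (g n \<omega>)))
            + cmod (lim (\<lambda>N. \<Sum>n\<in>freq (Suc N). wave \<theta> \<epsilon> t x n (g n \<omega>)) - F (t, x))"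
          using norm_triangle_ineq2[of "F (t, x)" "lim (\<lambda>N. \<Sum>n\<in>freq (Suc N). wave \<theta> \<epsilon> t x n (g n \<omega>))"]
          by (simp add: norm_minus_commute)
        moreover have "y = z / sqrt \<epsilon> + \<tau> / sqrt \<epsilon>"
          by (simp add: y_def add_divide_distrib)
        ultimately show "z / sqrt \<epsilon> < cmod (u_app \<theta> (\<lambda>n. g n \<omega>) \<epsilon> t x)"
          by (simp add: cmod_u_app)
      qed
    qed
    then have "prob (?E - B) \<le> prob (large_event \<theta> (T \<epsilon>) \<epsilon> (z / sqrt \<epsilon>))"
      by (intro finite_measure_mono) auto
    moreover have "prob ?E \<le> prob (?E - B) + prob B"
    proof -
      have "prob ?E \<le> prob ((?E - B) \<union> B)"
        using B by (intro finite_measure_mono) auto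
      also have "\<dots> \<le> prob (?E - B) + prob B"
        using B by (intro measure_Un_le) auto
      finally show ?thesis .
    qed
    moreover have "q * exp (- ((((z + \<tau>) + sqrt \<epsilon>)\<^sup>2 / s) / \<epsilon>)) \<le> prob ?E"
    proof -
      \<comment> \<open>On the scale of y the unit window becomes an increment sqrt \<epsilon>,
        which vanishes in the limit.\<close>
      have "y + 1 = ((z + \<tau>) + sqrt \<epsilon>) / sqrt \<epsilon>"
        using \<epsilon> by (simp add: y_def field_simps)
      then have "(y + 1)\<^sup>2 / s = (((z + \<tau>) + sqrt \<epsilon>)\<^sup>2 / s) / \<epsilon>"
        using \<epsilon> by (simp add: power_divide)
      moreover have "exp (- ((y + 1)\<^sup>2 / s)) / sqrt (pi * s) \<le> prob ?E"
        using ne assms \<tau> \<epsilon> by (intro Re_sum_lower_tail) (auto simp: s_def y_def coeff_c_pos)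
      ultimately show ?thesis
        by (simp add: q_def)
    qed
    ultimately show ?thesis
      using B(2) by linarith
  qed
  have "((\<lambda>\<epsilon>. ((z + \<tau>) + sqrt \<epsilon>)\<^sup>2 / s) \<longlongrightarrow> ((z + \<tau>) + sqrt 0)\<^sup>2 / s) (at_right 0)"
    using s0 by (intro tendsto_intros) auto
  then have ev1: "\<forall>\<^sub>F \<epsilon> in at_right 0. ((z + \<tau>) + sqrt \<epsilon>)\<^sup>2 / s < A + \<eta>"
    using s by (intro order_tendstoD) (auto simp: s_def)
  have "((\<lambda>\<epsilon>. C / \<epsilon> * exp (- (1 / \<epsilon>))) \<longlongrightarrow> 0) (at_right 0)"
    by real_asymp
  then have ev2: "\<forall>\<^sub>F \<epsilon> in at_right 0. C / \<epsilon> * exp (- (1 / \<epsilon>)) < q / 2"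
    using q by (intro order_tendstoD) auto
  have "\<forall>\<^sub>F \<epsilon> in at_right 0. \<epsilon> \<in> {0<..<1::real}"
    by (intro eventually_at_right_real) auto
  with ev1 ev2 have "\<forall>\<^sub>F \<epsilon> in at_right 0. q / 2 * exp (- ((A + \<eta>) / \<epsilon>)) \<le> prob (large_event \<theta> (T \<epsilon>) \<epsilon> (z / sqrt \<epsilon>))"
  proof eventually_elim
    case (elim \<epsilon>)
    then have \<epsilon>: "0 < \<epsilon>" "\<epsilon> \<le> 1"
      by auto
    have "q * exp (- ((A + \<eta>) / \<epsilon>)) \<le> q * exp (- ((((z + \<tau>) + sqrt \<epsilon>)\<^sup>2 / s) / \<epsilon>))"
      using divide_right_mono[OF less_imp_le[OF elim(1)], of \<epsilon>] q \<epsilon> by (intro mult_left_mono) auto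
    moreover have "C / \<epsilon> * exp (- ((A + \<eta> + 1) / \<epsilon>)) = C / \<epsilon> * exp (- (1 / \<epsilon>)) * exp (- ((A + \<eta>) / \<epsilon>))"
      by (simp add: exp_add[symmetric] add_divide_distrib)
    moreover have "C / \<epsilon> * exp (- (1 / \<epsilon>)) * exp (- ((A + \<eta>) / \<epsilon>)) \<le> q / 2 * exp (- ((A + \<eta>) / \<epsilon>))"
      using elim(2) by (intro mult_right_mono) auto
    ultimately show ?case
      using lower[OF \<epsilon>] by linarith
  qed
  with q show ?thesis
    unfolding A_def by (intro exI[of _ "q / 2"]) auto
qed

end

theorem lemma3p1:
  fixes M :: "'a measure" and g :: "int \<Rightarrow> 'a \<Rightarrow> complex"
    and \<theta> z\<^sub>0 :: real and T :: "real \<Rightarrow> real"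
  assumes "prob_space M"
    and "\<theta> > 0" and "z\<^sub>0 > 0"
    and "prob_space.indep_vars M (\<lambda>_. borel) g UNIV"
    and "\<And>n. standard_complex_gaussian M (g n)"
    and "\<And>\<epsilon>. \<epsilon> > 0 \<Longrightarrow> T \<epsilon> > 0"
    and "\<exists>K. \<forall>\<epsilon>>0. T \<epsilon> \<le> K * inverse \<epsilon>"
  shows "((\<lambda>\<epsilon>. \<epsilon> * ln (measure M {\<omega> \<in> space M.
             Linf_norm (T \<epsilon>) (u_app \<theta> (\<lambda>n. g n \<omega>) \<epsilon>) > ereal (z\<^sub>0 * \<epsilon> powr (- 1 / 2))}))
           \<longlongrightarrow> - (z\<^sub>0\<^sup>2 / (\<Sum>\<^sub>\<infinity>n\<in>UNIV. (coeff_c \<theta> n)\<^sup>2))) (at_right 0)"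
proof -
  interpret prob_space M by fact
  interpret gaussian_family M g
    by unfold_locales fact+
  obtain K where K: "\<And>\<epsilon>. \<epsilon> > 0 \<Longrightarrow> T \<epsilon> \<le> K / \<epsilon>"
    using assms(7) by (auto simp: divide_inverse)
  \<comment> \<open>The bound at \<epsilon> = 1 together with T 1 > 0 forces the sign.\<close>
  have "K > 0"
    using K[of 1] assms(6)[of 1] by simp
  define p where "p \<epsilon> = prob (large_event \<theta> (T \<epsilon>) \<epsilon> (z\<^sub>0 / sqrt \<epsilon>))" for \<epsilon>
  have "((\<lambda>\<epsilon>. \<epsilon> * ln (p \<epsilon>)) \<longlongrightarrow> - (z\<^sub>0\<^sup>2 / mass \<theta>)) (at_right 0)"
    unfolding p_def using assms(2,3,6) K \<open>K > 0\<close>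
    by (intro log_asymptotics large_event_upper[where K = K] large_event_lower[where K = K])
  \<comment> \<open>The two forms of the threshold are identified for positive \<epsilon>, which is
    all that the one-sided limit sees.\<close>
  moreover have "\<forall>\<^sub>F \<epsilon> in at_right 0. \<epsilon> * ln (p \<epsilon>) = \<epsilon> * ln (measure M {\<omega> \<in> space M.
             Linf_norm (T \<epsilon>) (u_app \<theta> (\<lambda>n. g n \<omega>) \<epsilon>) > ereal (z\<^sub>0 * \<epsilon> powr (- 1 / 2))})"
    using eventually_at_right_less[of 0]
  proof eventually_elim
    case (elim \<epsilon>)
    then have "z\<^sub>0 * \<epsilon> powr (- 1 / 2) = z\<^sub>0 / sqrt \<epsilon>"
      by (simp add: powr_minus_divide powr_half_sqrt)
    then show ?case
      by (simp add: p_def large_event_def)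
  qed
  ultimately show ?thesis
    unfolding mass_def by (rule Lim_transform_eventually)
qed

end
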